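(* Assume the following two conditions. (A) For some $0<q<1/2$ and $1<\rho<2(1-q)$ there exist a sequence $(\epsilon_n)_{n\ge1}$ of positive numbers with $\epsilon_n\downarrow0$ and, for each $n$, four consecutive members $E_{\rm a}(n)<E_{\rm b}(n)<E_{\rm c}(n)<E_{\rm d}(n)$ of the sequence $(E_j)_{j\ge1}$ such that, as $n\to\infty$, $$E_{\rm d}(n)\ll\epsilon_n^{-\rho},\quad E_{\rm c}(n)-E_{\rm b}(n)\ll\epsilon_n,\quad E_{\rm d}(n)-E_{\rm c}(n)\gg\epsilon_n^{q},\quad E_{\rm b}(n)-E_{\rm a}(n)\gg\epsilon_n^{q}.$$ (B) There is a constant $c_0>0$, independent of $j$, such that $|\Phi_j(p)|\ge c_0$ for all $j$. For each $n$ let $I_n=[E_{\rm b}(n),E_{\rm c}(n)]$, let $\mu_n\in I_n$ be the solution of $\sum_{E_j\in I_n}\frac{|\Phi_j(p)|^2}{E_j-\mu_n}=0$, and let $$\psi_n=\sum_{E_j\in I_n}\frac{\overline{\Phi_j(p)}}{E_j-\mu_n}\Phi_j .$$ Then the normalised quasimodes $\psi_n/\|\psi_n\|$ converge in $L^2$ to a sequence of true eigenfunctions of $H_\pi$; that is, there exist normalised eigenfunctions $\phi_n$ of $H_\pi$ such that $$\Bigl\|\phi_n-\frac{\psi_n}{\|\psi_n\|}\Bigr\|\to0\qquad(n\to\infty).$$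
   Context: Setting. $\mathcal M$ is a compact 2-dimensional Riemannian manifold, possibly with piecewise-smooth boundary, $\Delta$ is a self-adjoint Laplacian on $\mathcal M$, and $p\in\mathcal M$ is a fixed point. $\|\cdot\|$ and $\langle\cdot,\cdot\rangle$ are the norm and inner product (linear in the first argument) of $L^2(\mathcal M)$. $-\Delta$ has an orthonormal basis of eigenfunctions. In each eigenspace the orthonormal basis is chosen so that at most one basis element is nonzero at $p$; basis eigenfunctions vanishing at $p$ are discarded, and the remaining ones are denoted $\Phi_j$, with eigenvalues $E_1<E_2<E_3<\cdots$ (so $\Phi_j(p)\neq0$ and each $E_j$ is listed once). Weyl's law is a standing fact: $N(E):=\sum_{E_j\le E}|\Phi_j(p)|^2=\frac{E}{4\pi}+O(E^{1/2})$. The operator $H_\pi$ (the case $\Theta=\pi$ of the family $H_\Theta$). Let $g_{\pm i}:=\sum_{j\ge1}\frac{\overline{\Phi_j(p)}}{E_j\mp i}\Phi_j\in L^2(\mathcal M)$, $\mathcal D_p:=\{f\in\mathrm{Dom}(\Delta): f(p)=0\}$, and let $H_0$ be the symmetric operator $f\mapsto-\Delta f$ with domain $\mathcal D_p$. Its deficiency subspaces are spanned by $g_{i}$ and $g_{-i}$, so $\mathrm{Dom}(H_0^* )=\mathcal D_p\oplus\mathrm{span}\{g_i,g_{-i}\}$; every $\psi\in\mathrm{Dom}(H_0^* )$ is uniquely $\psi=\hat\psi+a_+(\psi)g_i+a_-(\psi)g_{-i}$ with $\hat\psi\in\mathcal D_p$, $a_\pm(\psi)\in\mathbb C$, and $H_0^*\psi=H_0\hat\psi+i\,a_+(\psi)g_i-i\,a_-(\psi)g_{-i}$.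 $H_\Theta$ is the self-adjoint restriction of $H_0^*$ to $\{\psi\in\mathrm{Dom}(H_0^* ): a_-(\psi)=-e^{i\Theta}a_+(\psi)\}$; for $\Theta=\pi$ the condition is $a_-(\psi)=a_+(\psi)$. $f\ll g$ (equivalently $g\gg f$) means $f\le Cg$ for some constant $C>0$ independent of $n$. *)

theory Defs
  imports "HOL-Analysis.Analysis" "HOL-Library.Landau_Symbols"
begin

section \<open>Smooth functions between Euclidean spaces\<close>

definition pd :: "'a::euclidean_space \<Rightarrow> ('a \<Rightarrow> 'b::real_normed_vector) \<Rightarrow> 'a \<Rightarrow> 'b" where
  "pd b f x = frechet_derivative f (at x) b"

primrec Ck_on :: "nat \<Rightarrow> ('a::euclidean_space \<Rightarrow> 'b::real_normed_vector) \<Rightarrow> 'a set \<Rightarrow> bool" where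
  "Ck_on 0 f S \<longleftrightarrow> continuous_on S f"
| "Ck_on (Suc k) f S \<longleftrightarrow> (\<forall>x\<in>S. f differentiable (at x)) \<and> (\<forall>b\<in>Basis. Ck_on k (pd b f) S)"

text \<open>Only used for open sets \<open>S\<close>; values of \<open>f\<close> outside \<open>S\<close> are then irrelevant.\<close>

definition smooth_on :: "('a::euclidean_space \<Rightarrow> 'b::real_normed_vector) \<Rightarrow> 'a set \<Rightarrow> bool" where
  "smooth_on f S \<longleftrightarrow> (\<forall>k. Ck_on k f S)"


section \<open>Riemannian surfaces\<close>

text \<open>A chart is a pair \<open>(U, h)\<close> of an open set and a coordinate map, of which only the values
  on \<open>U\<close> matter. A Riemannian metric \<open>G\<close> assigns to each chart the matrix \<open>(g\<^sub>i\<^sub>j)\<close> of the metric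
  as a function of the coordinates.\<close>

type_synonym 'a chart = "'a set \<times> ('a \<Rightarrow> real^2)"

definition chart_inv :: "'a chart \<Rightarrow> real^2 \<Rightarrow> 'a" where
  "chart_inv c = inv_into (fst c) (snd c)"

definition transition :: "'a chart \<Rightarrow> 'a chart \<Rightarrow> real^2 \<Rightarrow> real^2" where
  "transition c d = snd d \<circ> chart_inv c"

locale riemannian_surface =
  fixes A :: "'a::{t2_space,second_countable_topology} chart set"
    and G :: "'a chart \<Rightarrow> real^2 \<Rightarrow> real^2^2"
    and vol :: "'a measure"
  assumes chart_open: "c \<in> A \<Longrightarrow> open (fst c) \<and> open (snd c ` fst c)"
    and chart_homeo: "c \<in> A \<Longrightarrow> homeomorphism (fst c) (snd c ` fst c) (snd c) (chart_inv c)"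
    and atlas_cover: "(\<Union>c\<in>A. fst c) = UNIV"
    and atlas_smooth: "\<lbrakk>c \<in> A; d \<in> A\<rbrakk> \<Longrightarrow> smooth_on (transition c d) (snd c ` (fst c \<inter> fst d))"
    and metric_smooth: "c \<in> A \<Longrightarrow> smooth_on (G c) (snd c ` fst c)"
    and metric_sym: "\<lbrakk>c \<in> A; y \<in> snd c ` fst c\<rbrakk> \<Longrightarrow> transpose (G c y) = G c y"
    and metric_pos: "\<lbrakk>c \<in> A; y \<in> snd c ` fst c; v \<noteq> 0\<rbrakk> \<Longrightarrow> 0 < v \<bullet> (G c y *v v)"
    and metric_transform: "\<lbrakk>c \<in> A; d \<in> A; y \<in> snd c ` (fst c \<inter> fst d)\<rbrakk> \<Longrightarrow>
      (let J = matrix (frechet_derivative (transition c d) (at y))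
       in G c y = transpose J ** G d (transition c d y) ** J)"
    and vol_sets: "sets vol = sets borel"
    and vol_chart: "\<lbrakk>c \<in> A; S \<in> sets borel; S \<subseteq> fst c\<rbrakk> \<Longrightarrow>
      emeasure vol S = (\<integral>\<^sup>+y\<in>snd c ` S. ennreal (sqrt (det (G c y))) \<partial>lborel)"

definition smooth_fun :: "'a chart set \<Rightarrow> ('a \<Rightarrow> 'b::real_normed_vector) \<Rightarrow> bool" where
  "smooth_fun A f \<longleftrightarrow> (\<forall>c\<in>A. smooth_on (f \<circ> chart_inv c) (snd c ` fst c))"

text \<open>The Laplace--Beltrami operator (with the sign for which it is negative),
  \<open>|g|\<^sup>-\<^sup>1\<^sup>/\<^sup>2 \<Sum>\<^sub>i\<^sub>j \<partial>\<^sub>i (|g|\<^sup>1\<^sup>/\<^sup>2 g\<^sup>i\<^sup>j \<partial>\<^sub>j F)\<close> in coordinates. Its value at a point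
  does not depend on the chart, so an arbitrary chart around the point is used.\<close>

definition laplace_chart :: "(real^2 \<Rightarrow> real^2^2) \<Rightarrow> (real^2 \<Rightarrow> complex) \<Rightarrow> real^2 \<Rightarrow> complex" where
  "laplace_chart g F y =
     (\<Sum>i\<in>UNIV. \<Sum>j\<in>UNIV. pd (axis i 1)
        (\<lambda>z. (sqrt (det (g z)) * (matrix_inv (g z) $ i $ j)) *\<^sub>R pd (axis j 1) F z) y)
     /\<^sub>R sqrt (det (g y))"

definition laplace_beltrami ::
  "'a chart set \<Rightarrow> ('a chart \<Rightarrow> real^2 \<Rightarrow> real^2^2) \<Rightarrow> ('a \<Rightarrow> complex) \<Rightarrow> 'a \<Rightarrow> complex" where
  "laplace_beltrami A G f x =
     (let c = (SOME c. c \<in> A \<and> x \<in> fst c) in laplace_chart (G c) (f \<circ> chart_inv c) (snd c x))"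

text \<open>A smooth regular arc, parametrised by \<open>[0,1]\<close> and smooth beyond the end points.\<close>

definition smooth_arc :: "'a::topological_space chart set \<Rightarrow> (real \<Rightarrow> 'a) \<Rightarrow> bool" where
  "smooth_arc A \<gamma> \<longleftrightarrow> inj_on \<gamma> {0..1} \<and>
     (\<exists>\<delta>>0. continuous_on {-\<delta><..<1+\<delta>} \<gamma> \<and>
       (\<forall>c\<in>A. smooth_on (snd c \<circ> \<gamma>) {t\<in>{-\<delta><..<1+\<delta>}. \<gamma> t \<in> fst c} \<and>
              (\<forall>t\<in>{-\<delta><..<1+\<delta>}. \<gamma> t \<in> fst c \<longrightarrow> vector_derivative (snd c \<circ> \<gamma>) (at t) \<noteq> 0)))"

text \<open>A compact surface with (possibly empty) piecewise-smooth boundary is a compact subset \<open>M\<close> of a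
  Riemannian surface without boundary that is a topological surface with boundary and whose
  frontier consists of finitely many smooth arcs meeting only at end points. If the
  ambient surface is compact, \<open>M = UNIV\<close> is allowed.\<close>

locale compact_riemannian_surface = riemannian_surface A G vol
  for A :: "'a::{t2_space,second_countable_topology} chart set" and G vol +
  fixes M :: "'a set"
  assumes M_compact: "compact M"
    and M_manifold: "x \<in> M \<Longrightarrow>
      \<exists>V S. x \<in> V \<and> openin (top_of_set M) V \<and>
        openin (top_of_set {y::real^2. 0 \<le> y $ 2}) S \<and> V homeomorphic S"
    and M_boundary: "\<exists>\<Gamma>. finite \<Gamma> \<and> (\<forall>\<gamma>\<in>\<Gamma>. smooth_arc A \<gamma>) \<and>
      frontier M = (\<Union>\<gamma>\<in>\<Gamma>. \<gamma> ` {0..1}) \<and>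
      (\<forall>\<gamma>\<in>\<Gamma>. \<forall>\<gamma>'\<in>\<Gamma>. \<gamma> \<noteq> \<gamma>' \<longrightarrow> \<gamma> ` {0<..<1} \<inter> \<gamma>' ` {0..1} = {})"


section \<open>Square-integrable functions and unbounded operators\<close>

text \<open>Elements of \<open>L\<^sup>2\<close> are represented by functions; equality in \<open>L\<^sup>2\<close> is equality almost
  everywhere.\<close>

definition L2 :: "'a measure \<Rightarrow> ('a \<Rightarrow> complex) set" where
  "L2 \<mu> = {f \<in> borel_measurable \<mu>. integrable \<mu> (\<lambda>x. (cmod (f x))\<^sup>2)}"

definition l2inner :: "'a measure \<Rightarrow> ('a \<Rightarrow> complex) \<Rightarrow> ('a \<Rightarrow> complex) \<Rightarrow> complex" where
  "l2inner \<mu> f g = (LINT x|\<mu>. f x * cnj (g x))"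

definition l2norm :: "'a measure \<Rightarrow> ('a \<Rightarrow> complex) \<Rightarrow> real" where
  "l2norm \<mu> f = sqrt (LINT x|\<mu>. (cmod (f x))\<^sup>2)"

definition l2_sums :: "'a measure \<Rightarrow> (nat \<Rightarrow> 'a \<Rightarrow> complex) \<Rightarrow> ('a \<Rightarrow> complex) \<Rightarrow> bool" where
  "l2_sums \<mu> F g \<longleftrightarrow> g \<in> L2 \<mu> \<and>
     (\<lambda>n. l2norm \<mu> (\<lambda>x. g x - (\<Sum>j<n. F j x))) \<longlonglongrightarrow> 0"

definition l2_suminf :: "'a measure \<Rightarrow> (nat \<Rightarrow> 'a \<Rightarrow> complex) \<Rightarrow> 'a \<Rightarrow> complex" where
  "l2_suminf \<mu> F = (SOME g. l2_sums \<mu> F g)"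

definition orthonormal_basis :: "'a measure \<Rightarrow> ('a \<Rightarrow> complex) set \<Rightarrow> bool" where
  "orthonormal_basis \<mu> B \<longleftrightarrow> B \<subseteq> L2 \<mu> \<and>
     (\<forall>b\<in>B. \<forall>b'\<in>B. l2inner \<mu> b b' = (if b = b' then 1 else 0)) \<and>
     (\<forall>f\<in>L2 \<mu>. \<forall>e>0. \<exists>S c. finite S \<and> S \<subseteq> B \<and>
        l2norm \<mu> (\<lambda>x. f x - (\<Sum>b\<in>S. c b * b x)) < e)"

text \<open>An unbounded operator is given by its graph, a set of pairs of (representatives of) elements
  of \<open>L\<^sup>2\<close>. The adjoint of an operator is single-valued modulo null functions when the operator is
  densely defined.\<close>

type_synonym 'a operator = "(('a \<Rightarrow> complex) \<times> ('a \<Rightarrow> complex)) set"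

definition adjoint_op :: "'a measure \<Rightarrow> 'a operator \<Rightarrow> 'a operator" where
  "adjoint_op \<mu> T = {(g, h). g \<in> L2 \<mu> \<and> h \<in> L2 \<mu> \<and>
     (\<forall>(f, k)\<in>T. l2inner \<mu> k g = l2inner \<mu> f h)}"

definition self_adjoint :: "'a measure \<Rightarrow> 'a operator \<Rightarrow> bool" where
  "self_adjoint \<mu> T \<longleftrightarrow>
     (\<forall>f\<in>L2 \<mu>. \<forall>e>0. \<exists>g\<in>Domain T. l2norm \<mu> (\<lambda>x. f x - g x) < e) \<and> T = adjoint_op \<mu> T"

definition normalised_eigenfunction :: "'a measure \<Rightarrow> 'a operator \<Rightarrow> ('a \<Rightarrow> complex) \<Rightarrow> bool" where
  "normalised_eigenfunction \<mu> T f \<longleftrightarrow>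
     l2norm \<mu> f = 1 \<and> (\<exists>l::complex. (f, \<lambda>x. l * f x) \<in> T)"

definition self_adjoint_laplacian ::
  "'a::topological_space chart set \<Rightarrow> ('a chart \<Rightarrow> real^2 \<Rightarrow> real^2^2) \<Rightarrow> 'a measure \<Rightarrow> 'a set
     \<Rightarrow> 'a operator \<Rightarrow> bool" where
  "self_adjoint_laplacian A G \<mu> M \<Delta> \<longleftrightarrow> self_adjoint \<mu> \<Delta> \<and>
     (\<forall>f. smooth_fun A f \<and> compact (closure {x. f x \<noteq> 0}) \<and> closure {x. f x \<noteq> 0} \<subseteq> interior M
        \<longrightarrow> (f, laplace_beltrami A G f) \<in> \<Delta>)"

text \<open>The value at \<open>p\<close> of an element of \<open>L\<^sup>2\<close> is that of a representative continuous at \<open>p\<close>.\<close>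

definition has_value ::
  "'a measure \<Rightarrow> 'a::t2_space set \<Rightarrow> 'a \<Rightarrow> ('a \<Rightarrow> complex) \<Rightarrow> complex \<Rightarrow> bool" where
  "has_value \<mu> M p f z \<longleftrightarrow>
     (\<exists>f'. (AE x in \<mu>. f x = f' x) \<and> continuous (at p within M) f' \<and> f' p = z)"


section \<open>The point-perturbed Laplacian\<close>

definition D_p :: "'a measure \<Rightarrow> 'a::t2_space set \<Rightarrow> 'a operator \<Rightarrow> 'a
    \<Rightarrow> ('a \<Rightarrow> complex) set" where
  "D_p \<mu> M \<Delta> p = {f \<in> Domain \<Delta>. has_value \<mu> M p f 0}"

definition H_0 :: "'a measure \<Rightarrow> 'a::t2_space set \<Rightarrow> 'a operator \<Rightarrow> 'a \<Rightarrow> 'a operator" where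
  "H_0 \<mu> M \<Delta> p = {(f, \<lambda>x. - h x) | f h. (f, h) \<in> \<Delta> \<and> f \<in> D_p \<mu> M \<Delta> p}"

text \<open>\<open>g\<^sub>\<plusminus>\<^sub>i\<close> is \<open>g_vec \<mu> \<Phi> E p (\<plusminus> \<i>)\<close>.\<close>

definition g_vec :: "'a measure \<Rightarrow> (nat \<Rightarrow> 'a \<Rightarrow> complex) \<Rightarrow> (nat \<Rightarrow> real) \<Rightarrow> 'a \<Rightarrow> complex
    \<Rightarrow> 'a \<Rightarrow> complex" where
  "g_vec \<mu> \<Phi> E p w = l2_suminf \<mu> (\<lambda>j x. cnj (\<Phi> j p) / (of_real (E j) - w) * \<Phi> j x)"

definition H_op :: "'a measure \<Rightarrow> 'a::t2_space set \<Rightarrow> 'a operator \<Rightarrow> 'a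
    \<Rightarrow> (nat \<Rightarrow> 'a \<Rightarrow> complex) \<Rightarrow> (nat \<Rightarrow> real) \<Rightarrow> real \<Rightarrow> 'a operator" where
  "H_op \<mu> M \<Delta> p \<Phi> E \<Theta> = {(f, h) \<in> adjoint_op \<mu> (H_0 \<mu> M \<Delta> p).
     \<exists>f0\<in>D_p \<mu> M \<Delta> p. \<exists>a_plus a_minus. a_minus = - cis \<Theta> * a_plus \<and>
       (AE x in \<mu>. f x = f0 x + a_plus * g_vec \<mu> \<Phi> E p \<i> x + a_minus * g_vec \<mu> \<Phi> E p (- \<i>) x)}"

text \<open>\<open>B\<close> is the full orthonormal basis of eigenfunctions of \<open>-\<Delta>\<close>, represented by functions
  continuous at \<open>p\<close>; \<open>\<Phi>\<close> enumerates (from index \<open>0\<close>) the basis elements that do not vanish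
  at \<open>p\<close>. The assumption \<open>deficiency\<close> says that \<open>g\<^sub>\<plusminus>\<^sub>i\<close> spans the kernel of
  \<open>H\<^sub>0\<^sup>* \<mp> i\<close>.\<close>

locale point_scatterer = compact_riemannian_surface A G vol M
  for A :: "'a::{t2_space,second_countable_topology} chart set" and G vol M +
  fixes \<mu> :: "'a measure"
    and \<Delta> :: "'a operator"
    and p :: 'a
    and B :: "('a \<Rightarrow> complex) set"
    and \<Phi> :: "nat \<Rightarrow> 'a \<Rightarrow> complex"
    and E :: "nat \<Rightarrow> real"
  assumes mu_eq: "\<mu> = restrict_space vol M"
    and laplacian: "self_adjoint_laplacian A G \<mu> M \<Delta>"
    and p_in: "p \<in> M"
    and point_values: "f \<in> Domain \<Delta> \<Longrightarrow> \<exists>z. has_value \<mu> M p f z"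
    and basis: "orthonormal_basis \<mu> B"
    and basis_eigen: "b \<in> B \<Longrightarrow> \<exists>l::real. (b, \<lambda>x. - of_real l * b x) \<in> \<Delta>"
    and basis_cont: "b \<in> B \<Longrightarrow> continuous (at p within M) b"
    and basis_choice: "\<lbrakk>b \<in> B; b' \<in> B; (b, \<lambda>x. - of_real l * b x) \<in> \<Delta>;
      (b', \<lambda>x. - of_real l * b' x) \<in> \<Delta>; b p \<noteq> 0; b' p \<noteq> 0\<rbrakk> \<Longrightarrow> b = b'"
    and Phi_enum: "bij_betw \<Phi> UNIV {b \<in> B. b p \<noteq> 0}"
    and Phi_eigen: "(\<Phi> j, \<lambda>x. - of_real (E j) * \<Phi> j x) \<in> \<Delta>"
    and E_mono: "strict_mono E"
    and weyl: "(\<lambda>x. (\<Sum>j\<in>{j. E j \<le> x}. (cmod (\<Phi> j p))\<^sup>2) - x / (4 * pi)) \<in> O(\<lambda>x. x powr (1/2))"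
    and deficiency: "w \<in> {\<i>, - \<i>} \<Longrightarrow>
      {f \<in> L2 \<mu>. (f, \<lambda>x. w * f x) \<in> adjoint_op \<mu> (H_0 \<mu> M \<Delta> p)} =
      {f \<in> L2 \<mu>. \<exists>c. AE x in \<mu>. f x = c * g_vec \<mu> \<Phi> E p w x}"


section \<open>Quasimodes\<close>

definition vless :: "(nat \<Rightarrow> real) \<Rightarrow> (nat \<Rightarrow> real) \<Rightarrow> bool" (infix "\<lless>" 50) where
  "f \<lless> g \<longleftrightarrow> (\<exists>C>0. \<forall>n. f n \<le> C * g n)"

definition quasimode :: "(nat \<Rightarrow> 'a \<Rightarrow> complex) \<Rightarrow> (nat \<Rightarrow> real) \<Rightarrow> 'a \<Rightarrow> real set \<Rightarrow> real
    \<Rightarrow> 'a \<Rightarrow> complex" where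
  "quasimode \<Phi> E p I m =
     (\<lambda>x. \<Sum>j\<in>{j. E j \<in> I}. cnj (\<Phi> j p) / of_real (E j - m) * \<Phi> j x)"

end

theory Submission
  imports Defs
begin

text \<open>For \<open>\<lambda>\<close> outside the spectrum let \<open>G\<^sub>\<lambda> = \<Sum>\<^sub>j cnj (\<Phi>\<^sub>j(p)) / (E\<^sub>j - \<lambda>) \<Phi>\<^sub>j\<close>. It is an eigenfunction
  of \<open>H\<^sub>\<pi>\<close> as soon as \<open>F(\<lambda>) = \<Sum>\<^sub>j \<bar>\<Phi>\<^sub>j(p)\<bar>\<^sup>2 (1 / (E\<^sub>j - \<lambda>) - E\<^sub>j / (E\<^sub>j\<^sup>2 + 1)) = 0\<close>, because
  \<open>G\<^sub>\<lambda> - (g\<^sub>i + g\<^sub>-\<^sub>i) / 2\<close> lies in the domain of \<open>\<Delta>\<close> and has the value \<open>F(\<lambda>)\<close> at \<open>p\<close>. Between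
  \<open>E\<^sub>b\<close> and \<open>E\<^sub>c\<close> the function \<open>F\<close> has a zero \<open>\<lambda>\<close>. There \<open>F\<close> is the sum of the two polar terms at
  \<open>E\<^sub>b\<close> and \<open>E\<^sub>c\<close>, which vanishes at \<open>\<mu>\<close>, and of a remainder which by Weyl's law, used on a window of
  width \<open>\<surd>\<lambda>\<close> around \<open>\<lambda>\<close>, is \<open>O(\<surd>\<lambda> \<epsilon>\<^sup>-\<^sup>q)\<close> up to the two regularising terms of \<open>b\<close> and \<open>c\<close>. Hence the
  coefficients of \<open>G\<^sub>\<lambda>\<close> and \<open>\<psi>\<close> at \<open>b\<close> and \<open>c\<close> differ by a relative error
  \<open>O(\<surd>\<lambda> \<epsilon>\<^sup>1\<^sup>-\<^sup>q)\<close>. The other coefficients of \<open>G\<^sub>\<lambda>\<close> have square sum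
  \<open>O(\<surd>\<lambda> \<epsilon>\<^sup>-\<^sup>2\<^sup>q)\<close>, while \<open>\<parallel>\<psi>\<parallel>\<^sup>2\<close> is at least of order \<open>\<epsilon>\<^sup>-\<^sup>2\<close>. Since
  \<open>\<lambda> = O(\<epsilon>\<^sup>-\<^sup>\<rho>)\<close> and \<open>\<rho> < 2 (1 - q)\<close>, both errors vanish in the limit.\<close>

section \<open>Square-integrable functions\<close>

lemma L2_D:
  assumes "f \<in> L2 \<mu>"
  shows "f \<in> borel_measurable \<mu>" "integrable \<mu> (\<lambda>x. (cmod (f x))\<^sup>2)"
  using assms by (auto simp: L2_def)

lemma L2_scale:
  assumes "f \<in> L2 \<mu>"
  shows "(\<lambda>x. a * f x) \<in> L2 \<mu>"
  using assms by (auto simp: L2_def norm_mult power_mult_distrib)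

lemma L2_add:
  assumes f: "f \<in> L2 \<mu>" and g: "g \<in> L2 \<mu>"
  shows "(\<lambda>x. f x + g x) \<in> L2 \<mu>"
proof -
  note [measurable] = L2_D(1)[OF f] L2_D(1)[OF g]
  have int: "integrable \<mu> (\<lambda>x. 2 * (cmod (f x))\<^sup>2 + 2 * (cmod (g x))\<^sup>2)"
    using f g by (intro Bochner_Integration.integrable_add integrable_mult_right) (auto simp: L2_def)
  have bound: "(cmod (f x + g x))\<^sup>2 \<le> 2 * (cmod (f x))\<^sup>2 + 2 * (cmod (g x))\<^sup>2" for x
    using power_mono[OF norm_triangle_ineq[of "f x" "g x"], of 2] sum_squares_bound[of "cmod (f x)" "cmod (g x)"]
    by (simp add: power2_sum)
  have "integrable \<mu> (\<lambda>x. (cmod (f x + g x))\<^sup>2)"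
    by (rule Bochner_Integration.integrable_bound[OF int]) (use bound in auto)
  then show ?thesis by (auto simp: L2_def)
qed

lemma L2_diff:
  assumes "f \<in> L2 \<mu>" and "g \<in> L2 \<mu>"
  shows "(\<lambda>x. f x - g x) \<in> L2 \<mu>"
  using L2_add[OF assms(1) L2_scale[OF assms(2), of "-1"]] by simp

lemma L2_sum:
  assumes "\<And>j. j \<in> S \<Longrightarrow> F j \<in> L2 \<mu>"
  shows "(\<lambda>x. \<Sum>j\<in>S. F j x) \<in> L2 \<mu>"
  using assms
proof (induction S rule: infinite_finite_induct)
  case (insert j S)
  then show ?case by (simp add: L2_add)
qed (auto simp: L2_def)

section \<open>Inner product and norm of square-integrable functions\<close>

lemma l2inner_integrable:
  assumes f: "f \<in> L2 \<mu>" and g: "g \<in> L2 \<mu>"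
  shows "integrable \<mu> (\<lambda>x. f x * cnj (g x))"
proof -
  note [measurable] = L2_D(1)[OF f] L2_D(1)[OF g]
  have [measurable]: "(\<lambda>x. cnj (g x)) \<in> borel_measurable \<mu>"
    by (rule borel_measurable_continuous_on[OF continuous_on_cnj[OF continuous_on_id]]) simp
  have int: "integrable \<mu> (\<lambda>x. (cmod (f x))\<^sup>2 + (cmod (g x))\<^sup>2)"
    using f g by (intro Bochner_Integration.integrable_add) (auto simp: L2_def)
  have bound: "cmod (f x * cnj (g x)) \<le> (cmod (f x))\<^sup>2 + (cmod (g x))\<^sup>2" for x
    using sum_squares_bound[of "cmod (f x)" "cmod (g x)"] norm_ge_zero[of "f x * g x"]
    unfolding norm_mult complex_mod_cnj by linarith
  show ?thesis
    by (rule Bochner_Integration.integrable_bound[OF int]) (use bound in auto)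
qed

lemma l2inner_add_left:
  assumes "f \<in> L2 \<mu>" "g \<in> L2 \<mu>" "u \<in> L2 \<mu>"
  shows "l2inner \<mu> (\<lambda>x. f x + g x) u = l2inner \<mu> f u + l2inner \<mu> g u"
  using assms unfolding l2inner_def
  by (subst Bochner_Integration.integral_add[symmetric]) (auto intro: l2inner_integrable simp: algebra_simps)

lemma l2inner_scale_left: "l2inner \<mu> (\<lambda>x. a * f x) u = a * l2inner \<mu> f u"
  by (simp add: l2inner_def mult.assoc)

lemma l2inner_cnj: "cnj (l2inner \<mu> f g) = l2inner \<mu> g f"
  unfolding l2inner_def by (subst Bochner_Integration.integral_cnj[symmetric]) (simp add: mult.commute)

lemma l2inner_diff_left:
  assumes "f \<in> L2 \<mu>" "g \<in> L2 \<mu>" "u \<in> L2 \<mu>"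
  shows "l2inner \<mu> (\<lambda>x. f x - g x) u = l2inner \<mu> f u - l2inner \<mu> g u"
  using assms unfolding l2inner_def
  by (subst Bochner_Integration.integral_diff[symmetric]) (auto intro: l2inner_integrable simp: algebra_simps)

lemma l2inner_add_right:
  assumes "f \<in> L2 \<mu>" "g \<in> L2 \<mu>" "u \<in> L2 \<mu>"
  shows "l2inner \<mu> u (\<lambda>x. f x + g x) = l2inner \<mu> u f + l2inner \<mu> u g"
  using l2inner_add_left[OF assms] by (metis complex_cnj_add l2inner_cnj)

lemma l2inner_diff_right:
  assumes "f \<in> L2 \<mu>" "g \<in> L2 \<mu>" "u \<in> L2 \<mu>"
  shows "l2inner \<mu> u (\<lambda>x. f x - g x) = l2inner \<mu> u f - l2inner \<mu> u g"
  using l2inner_diff_left[OF assms] by (metis complex_cnj_diff l2inner_cnj)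

lemma l2inner_scale_right: "l2inner \<mu> u (\<lambda>x. a * f x) = cnj a * l2inner \<mu> u f"
  by (metis complex_cnj_mult l2inner_cnj l2inner_scale_left)

lemma l2inner_sum_right:
  assumes "\<And>j. j \<in> S \<Longrightarrow> F j \<in> L2 \<mu>" "u \<in> L2 \<mu>"
  shows "l2inner \<mu> u (\<lambda>x. \<Sum>j\<in>S. F j x) = (\<Sum>j\<in>S. l2inner \<mu> u (F j))"
  using assms
proof (induction S rule: infinite_finite_induct)
  case (insert j S)
  then show ?case by (simp add: l2inner_add_right L2_sum)
qed (auto simp: l2inner_def)

lemma l2norm_nonneg [simp]: "0 \<le> l2norm \<mu> f"
  by (simp add: l2norm_def)

lemma l2norm_power2: "(l2norm \<mu> f)\<^sup>2 = (LINT x|\<mu>. (cmod (f x))\<^sup>2)"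
  by (simp add: l2norm_def)

lemma l2inner_self: "l2inner \<mu> f f = of_real ((l2norm \<mu> f)\<^sup>2)"
proof -
  have "l2inner \<mu> f f = (LINT x|\<mu>. complex_of_real ((cmod (f x))\<^sup>2))"
    unfolding l2inner_def by (simp only: complex_norm_square)
  also have "\<dots> = of_real ((l2norm \<mu> f)\<^sup>2)"
    by (simp only: l2norm_power2 integral_complex_of_real)
  finally show ?thesis .
qed

lemma l2norm_scale: "l2norm \<mu> (\<lambda>x. a * f x) = cmod a * l2norm \<mu> f"
  by (simp add: l2norm_def norm_mult power_mult_distrib real_sqrt_mult)

lemma l2norm_diff_commute: "l2norm \<mu> (\<lambda>x. f x - g x) = l2norm \<mu> (\<lambda>x. g x - f x)"
  by (simp add: l2norm_def norm_minus_commute)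

text \<open>Integrates a weighted arithmetic-geometric mean inequality whose weights make both
  halves equal to \<open>F * N / 2\<close>. The weights require positive norms. A zero norm only
  says that the function vanishes almost everywhere, which still makes the inner product 0.\<close>

lemma l2_Cauchy_Schwarz:
  assumes f: "f \<in> L2 \<mu>" and g: "g \<in> L2 \<mu>"
  shows "cmod (l2inner \<mu> f g) \<le> l2norm \<mu> f * l2norm \<mu> g"
proof -
  note meas [measurable] = L2_D(1)[OF f] L2_D(1)[OF g]
  have zero: "l2inner \<mu> u v = 0"
    if "l2norm \<mu> u = 0" "u \<in> L2 \<mu>" for u v
  proof -
    note [measurable] = L2_D(1)[OF that(2)]
    have "(LINT x|\<mu>. (cmod (u x))\<^sup>2) = 0"
      using l2norm_power2[of \<mu> u] that(1) by simp
    then have "AE x in \<mu>. (cmod (u x))\<^sup>2 = 0"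
      using integral_nonneg_eq_0_iff_AE[OF L2_D(2)[OF that(2)]] by simp
    then have "AE x in \<mu>. u x * cnj (v x) = 0" by auto
    then show ?thesis unfolding l2inner_def by (rule integral_eq_zero_AE)
  qed
  show ?thesis
  proof (cases "l2norm \<mu> f = 0 \<or> l2norm \<mu> g = 0")
    case True
    then have "l2inner \<mu> f g = 0"
      using zero[of f g] zero[of g f] f g l2inner_cnj[of \<mu> g f] by auto
    then show ?thesis using True by auto
  next
    case False
    define F where "F = l2norm \<mu> f"
    define N where "N = l2norm \<mu> g"
    have pos: "F > 0" "N > 0"
      using False l2norm_nonneg[of \<mu> f] l2norm_nonneg[of \<mu> g] unfolding F_def N_def by linarith+
    have "cmod (l2inner \<mu> f g) \<le> (LINT x|\<mu>. cmod (f x * cnj (g x)))"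
      unfolding l2inner_def by (rule integral_norm_bound)
    also have "\<dots> \<le> (LINT x|\<mu>. (N / (2 * F)) * (cmod (f x))\<^sup>2 + (F / (2 * N)) * (cmod (g x))\<^sup>2)"
    proof (rule integral_mono)
      show "integrable \<mu> (\<lambda>x. cmod (f x * cnj (g x)))"
        by (intro integrable_norm l2inner_integrable f g)
      show "integrable \<mu> (\<lambda>x. (N / (2 * F)) * (cmod (f x))\<^sup>2 + (F / (2 * N)) * (cmod (g x))\<^sup>2)"
        using L2_D(2)[OF f] L2_D(2)[OF g] by auto
      fix x
      have "0 \<le> (N * cmod (f x) - F * cmod (g x))\<^sup>2" by simp
      then have "2 * (N * F) * (cmod (f x) * cmod (g x)) \<le> N\<^sup>2 * (cmod (f x))\<^sup>2 + F\<^sup>2 * (cmod (g x))\<^sup>2"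
        by (simp add: power2_diff power_mult_distrib algebra_simps)
      then have "cmod (f x) * cmod (g x) \<le> (N\<^sup>2 * (cmod (f x))\<^sup>2 + F\<^sup>2 * (cmod (g x))\<^sup>2) / (2 * (N * F))"
        using pos by (simp add: pos_le_divide_eq mult.commute)
      also have "\<dots> = (N / (2 * F)) * (cmod (f x))\<^sup>2 + (F / (2 * N)) * (cmod (g x))\<^sup>2"
        using pos by (simp add: field_simps power2_eq_square)
      finally show "cmod (f x * cnj (g x)) \<le> (N / (2 * F)) * (cmod (f x))\<^sup>2 + (F / (2 * N)) * (cmod (g x))\<^sup>2"
        by (simp add: norm_mult)
    qed
    also have "\<dots> = (N / (2 * F)) * F\<^sup>2 + (F / (2 * N)) * N\<^sup>2"
      using L2_D(2)[OF f] L2_D(2)[OF g] by (simp add: F_def N_def l2norm_power2)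
    also have "\<dots> = F * N" using pos by (simp add: field_simps power2_eq_square)
    finally show ?thesis by (simp add: F_def N_def)
  qed
qed

lemma l2norm_add_power2:
  assumes f: "f \<in> L2 \<mu>" and g: "g \<in> L2 \<mu>"
  shows "(l2norm \<mu> (\<lambda>x. f x + g x))\<^sup>2 = (l2norm \<mu> f)\<^sup>2 + (l2norm \<mu> g)\<^sup>2 + 2 * Re (l2inner \<mu> f g)"
proof -
  let ?h = "\<lambda>x. f x + g x"
  have h: "?h \<in> L2 \<mu>" using f g by (rule L2_add)
  have "l2inner \<mu> ?h ?h = l2inner \<mu> f f + l2inner \<mu> g g + (l2inner \<mu> f g + cnj (l2inner \<mu> f g))"
    using f g h by (simp add: l2inner_add_left l2inner_add_right l2inner_cnj)
  then have "complex_of_real ((l2norm \<mu> ?h)\<^sup>2)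
      = of_real ((l2norm \<mu> f)\<^sup>2 + (l2norm \<mu> g)\<^sup>2 + 2 * Re (l2inner \<mu> f g))"
    by (simp only: l2inner_self complex_add_cnj of_real_add of_real_mult of_real_numeral)
  then show ?thesis by (simp only: of_real_eq_iff)
qed

lemma l2norm_triangle:
  assumes f: "f \<in> L2 \<mu>" and g: "g \<in> L2 \<mu>"
  shows "l2norm \<mu> (\<lambda>x. f x + g x) \<le> l2norm \<mu> f + l2norm \<mu> g"
proof (rule power2_le_imp_le)
  have "Re (l2inner \<mu> f g) \<le> l2norm \<mu> f * l2norm \<mu> g"
    using l2_Cauchy_Schwarz[OF f g] complex_Re_le_cmod[of "l2inner \<mu> f g"] by linarith
  then show "(l2norm \<mu> (\<lambda>x. f x + g x))\<^sup>2 \<le> (l2norm \<mu> f + l2norm \<mu> g)\<^sup>2"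
    unfolding l2norm_add_power2[OF f g] by (simp add: power2_sum)
qed simp

section \<open>Completeness of the space of square-integrable functions\<close>

lemma nn_integral_cmod_power2:
  assumes "f \<in> L2 \<mu>"
  shows "(\<integral>\<^sup>+x. ennreal ((cmod (f x))\<^sup>2) \<partial>\<mu>) = ennreal ((l2norm \<mu> f)\<^sup>2)"
  unfolding l2norm_power2 using L2_D(2)[OF assms] by (rule nn_integral_eq_integral) auto

text \<open>Since \<open>2\<bar>d\<^sub>k\<bar> \<le> 2\<^sup>-\<^sup>k + 2\<^sup>k\<bar>d\<^sub>k\<bar>\<^sup>2\<close>, a sequence whose increments satisfy
  \<open>\<parallel>d\<^sub>k\<parallel>\<^sup>2 \<le> 4\<^sup>-\<^sup>k\<close> converges almost everywhere.\<close>

lemma AE_convergent_of_fast_Cauchy: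
  assumes T: "\<And>k. T k \<in> L2 \<mu>"
    and fast: "\<And>k. (l2norm \<mu> (\<lambda>x. T (Suc k) x - T k x))\<^sup>2 \<le> (1/4) ^ k"
  shows "AE x in \<mu>. convergent (\<lambda>k. T k x)"
proof -
  note [measurable] = L2_D(1)[OF T]
  define d where "d k x = T (Suc k) x - T k x" for k x
  have d: "d k \<in> L2 \<mu>" for k unfolding d_def by (intro L2_diff T)
  note [measurable] = L2_D(1)[OF d]
  have "(\<integral>\<^sup>+x. (\<Sum>k. ennreal (2 ^ k * (cmod (d k x))\<^sup>2)) \<partial>\<mu>)
      = (\<Sum>k. \<integral>\<^sup>+x. ennreal (2 ^ k * (cmod (d k x))\<^sup>2) \<partial>\<mu>)"
    by (rule nn_integral_suminf) simp
  also have "\<dots> \<le> (\<Sum>k. ennreal ((1/2) ^ k))"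
  proof (intro suminf_le)
    fix k
    have "(\<integral>\<^sup>+x. ennreal (2 ^ k * (cmod (d k x))\<^sup>2) \<partial>\<mu>) = ennreal (2 ^ k * (l2norm \<mu> (d k))\<^sup>2)"
      by (simp add: ennreal_mult nn_integral_cmult nn_integral_cmod_power2[OF d])
    also have "\<dots> \<le> ennreal (2 ^ k * (1/4) ^ k)"
      using fast[of k] unfolding d_def by (intro ennreal_leI mult_left_mono) auto
    also have "(2::real) ^ k * (1/4) ^ k = (1/2) ^ k"
      by (simp flip: power_mult_distrib)
    finally show "(\<integral>\<^sup>+x. ennreal (2 ^ k * (cmod (d k x))\<^sup>2) \<partial>\<mu>) \<le> ennreal ((1/2) ^ k)" .
  qed auto
  also have "\<dots> = ennreal (\<Sum>k. (1/2) ^ k)"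
    by (rule suminf_ennreal2) (auto simp: summable_geometric)
  also have "\<dots> < \<infinity>" by simp
  finally have fin: "(\<integral>\<^sup>+x. (\<Sum>k. ennreal (2 ^ k * (cmod (d k x))\<^sup>2)) \<partial>\<mu>) < \<infinity>" .
  have "AE x in \<mu>. (\<Sum>k. ennreal (2 ^ k * (cmod (d k x))\<^sup>2)) \<noteq> \<infinity>"
    by (rule nn_integral_PInf_AE[OF _ less_imp_neq[OF fin]]) measurable
  then show ?thesis
  proof (eventually_elim)
    case (elim x)
    have s: "summable (\<lambda>k. 2 ^ k * (cmod (d k x))\<^sup>2)"
      using elim by (intro summable_suminf_not_top) simp_all
    have "summable (\<lambda>k. d k x)"
    proof (rule summable_comparison_test', rule summable_add)
      show "summable (\<lambda>k. 2 ^ k * (cmod (d k x))\<^sup>2)" by (rule s)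
      show "summable (\<lambda>k. (1/2) ^ k :: real)" by (simp add: summable_geometric)
      fix k
      have "0 \<le> (2 ^ k * cmod (d k x) - 1)\<^sup>2 / 2 ^ k" by simp
      also have "\<dots> = 2 ^ k * (cmod (d k x))\<^sup>2 + (1/2) ^ k - 2 * cmod (d k x)"
        by (simp add: power2_diff field_simps power2_eq_square power_divide)
      finally show "cmod (d k x) \<le> 2 ^ k * (cmod (d k x))\<^sup>2 + (1/2) ^ k"
        using norm_ge_zero[of "d k x"] by linarith
    qed
    then have "convergent (\<lambda>n. T n x - T 0 x)"
      unfolding summable_iff_convergent d_def sum_lessThan_telescope[of "\<lambda>k. T k x"] .
    from convergent_add[OF this convergent_const[of "T 0 x"]] show ?case by simp
  qed
qed

text \<open>Riesz-Fischer: a subsequence with geometrically small increments converges almost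
  everywhere, and Fatou's lemma carries the Cauchy bound over to its limit, for every index of the
  original sequence and not just along the subsequence.\<close>

lemma L2_complete:
  assumes S: "\<And>n. S n \<in> L2 \<mu>"
    and cauchy: "\<And>e. 0 < e \<Longrightarrow> \<exists>N. \<forall>m\<ge>N. \<forall>n\<ge>N. l2norm \<mu> (\<lambda>x. S m x - S n x) \<le> e"
  shows "\<exists>g\<in>L2 \<mu>. (\<lambda>n. l2norm \<mu> (\<lambda>x. g x - S n x)) \<longlonglongrightarrow> 0"
proof -
  note [measurable] = L2_D(1)[OF S]
  have "\<exists>N. \<forall>m\<ge>N. \<forall>n\<ge>N. l2norm \<mu> (\<lambda>x. S m x - S n x) \<le> (1/2) ^ k" for k
    by (rule cauchy) simp
  then obtain N where N: "\<And>k m n. m \<ge> N k \<Longrightarrow> n \<ge> N k \<Longrightarrow> l2norm \<mu> (\<lambda>x. S m x - S n x) \<le> (1/2) ^ k"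
    by metis
  \<comment> \<open>Summing all thresholds up to \<open>k\<close> lets \<open>r k\<close> and
    \<open>r (Suc k)\<close> both reach \<open>N k\<close>; the summand \<open>k\<close> sends
    \<open>r k\<close> to infinity.\<close>
  define r where "r k = (\<Sum>i\<le>k. N i) + k" for k
  have rN: "r k \<ge> N k" for k unfolding r_def by (simp add: sum.atMost_Suc_shift member_le_sum trans_le_add1)
  have rk: "r k \<ge> k" for k unfolding r_def by simp
  have rS: "r (Suc k) \<ge> N k" for k unfolding r_def
    by (metis member_le_sum atMost_iff finite_atMost le_SucI order_refl trans_le_add1 zero_le)
  define T where "T k = S (r k)" for k
  have T: "T k \<in> L2 \<mu>" for k unfolding T_def by (rule S)
  note [measurable] = L2_D(1)[OF T]
  have fast: "(l2norm \<mu> (\<lambda>x. T (Suc k) x - T k x))\<^sup>2 \<le> (1/4) ^ k" for k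
  proof -
    have "(l2norm \<mu> (\<lambda>x. T (Suc k) x - T k x))\<^sup>2 \<le> ((1/2) ^ k)\<^sup>2"
      unfolding T_def by (intro power_mono N rN rS) simp
    also have "((1/2::real) ^ k)\<^sup>2 = (1/4) ^ k"
      by (simp add: power2_eq_square flip: power_mult_distrib)
    finally show ?thesis .
  qed
  \<comment> \<open>Where \<open>T k x\<close> diverges, \<open>lim\<close> is an unspecified value;
    this happens on a null set only, and \<open>g\<close> is measurable all the same.\<close>
  define g where "g x = lim (\<lambda>k. T k x)" for x
  have g[measurable]: "g \<in> borel_measurable \<mu>" unfolding g_def by measurable
  have AE: "AE x in \<mu>. (\<lambda>k. T k x) \<longlonglongrightarrow> g x"
    using AE_convergent_of_fast_Cauchy[OF T fast] by (simp add: g_def convergent_LIMSEQ_iff)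
  have bound: "(\<integral>\<^sup>+x. ennreal ((cmod (g x - S n x))\<^sup>2) \<partial>\<mu>) \<le> ennreal (e\<^sup>2)"
    if e: "e > 0" and n: "\<forall>m\<ge>n. l2norm \<mu> (\<lambda>x. S m x - S n x) \<le> e" for e n
  proof -
    have "(\<integral>\<^sup>+x. ennreal ((cmod (g x - S n x))\<^sup>2) \<partial>\<mu>)
        = (\<integral>\<^sup>+x. liminf (\<lambda>k. ennreal ((cmod (T k x - S n x))\<^sup>2)) \<partial>\<mu>)"
    proof (rule nn_integral_cong_AE, use AE in eventually_elim)
      case (elim x)
      then have lim: "(\<lambda>k. ennreal ((cmod (T k x - S n x))\<^sup>2)) \<longlonglongrightarrow> ennreal ((cmod (g x - S n x))\<^sup>2)"
        by (intro tendsto_ennrealI tendsto_intros)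
      show ?case by (rule lim_imp_Liminf[OF sequentially_bot lim, symmetric])
    qed
    also have "\<dots> \<le> liminf (\<lambda>k. \<integral>\<^sup>+x. ennreal ((cmod (T k x - S n x))\<^sup>2) \<partial>\<mu>)"
      by (rule nn_integral_liminf) simp
    also have "\<dots> = liminf (\<lambda>k. ennreal ((l2norm \<mu> (\<lambda>x. T k x - S n x))\<^sup>2))"
      by (simp add: nn_integral_cmod_power2 L2_diff T S)
    also have "\<dots> \<le> limsup (\<lambda>k. ennreal ((l2norm \<mu> (\<lambda>x. T k x - S n x))\<^sup>2))"
      by (rule Liminf_le_Limsup) simp
    also have "\<dots> \<le> ennreal (e\<^sup>2)"
    proof (rule Limsup_bounded)
      show "\<forall>\<^sub>F k in sequentially. ennreal ((l2norm \<mu> (\<lambda>x. T k x - S n x))\<^sup>2) \<le> ennreal (e\<^sup>2)"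
        using eventually_ge_at_top[of n]
      proof eventually_elim
        case (elim k)
        then have "r k \<ge> n" using rk[of k] by linarith
        then have "l2norm \<mu> (\<lambda>x. T k x - S n x) \<le> e" unfolding T_def using n by blast
        then show ?case by (intro ennreal_leI power_mono l2norm_nonneg)
      qed
    qed
    finally show ?thesis .
  qed
  \<comment> \<open>The Bochner integral in \<open>l2norm\<close> is informative only for integrable
    functions, so integrability is first drawn from the bound on the
    \<open>nn_integral\<close>.\<close>
  have diff: "(\<lambda>x. g x - S n x) \<in> L2 \<mu>"
    if e: "e > 0" and n: "\<forall>m\<ge>n. l2norm \<mu> (\<lambda>x. S m x - S n x) \<le> e" for e n
  proof -
    have "(\<integral>\<^sup>+x. ennreal (norm ((cmod (g x - S n x))\<^sup>2)) \<partial>\<mu>) \<le> ennreal (e\<^sup>2)"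
      using bound[OF that] by simp
    also have "\<dots> < \<infinity>" by simp
    finally have "integrable \<mu> (\<lambda>x. (cmod (g x - S n x))\<^sup>2)"
      by (intro integrableI_bounded) auto
    then show ?thesis by (auto simp: L2_def)
  qed
  obtain N1 where N1: "\<forall>m\<ge>N1. \<forall>n\<ge>N1. l2norm \<mu> (\<lambda>x. S m x - S n x) \<le> 1"
    using cauchy[of 1] by auto
  have gL2: "g \<in> L2 \<mu>"
    using L2_add[OF diff[of 1 N1] S[of N1]] N1 by auto
  have "(\<lambda>n. l2norm \<mu> (\<lambda>x. g x - S n x)) \<longlonglongrightarrow> 0"
  proof (rule LIMSEQ_I)
    fix e :: real assume e: "0 < e"
    then obtain N where N: "\<forall>m\<ge>N. \<forall>n\<ge>N. l2norm \<mu> (\<lambda>x. S m x - S n x) \<le> e / 2"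
      using cauchy[of "e/2"] by auto
    have "norm (l2norm \<mu> (\<lambda>x. g x - S n x) - 0) < e" if n: "n \<ge> N" for n
    proof -
      have "ennreal ((l2norm \<mu> (\<lambda>x. g x - S n x))\<^sup>2) \<le> ennreal ((e/2)\<^sup>2)"
        using bound[of "e/2" n] N n e by (simp add: nn_integral_cmod_power2 L2_diff gL2 S)
      then have "(l2norm \<mu> (\<lambda>x. g x - S n x))\<^sup>2 \<le> (e/2)\<^sup>2"
        using ennreal_le_iff[OF zero_le_power2] by blast
      then have "l2norm \<mu> (\<lambda>x. g x - S n x) \<le> e/2" using e by (rule power2_le_imp_le[OF _ less_imp_le[OF half_gt_zero]])
      then show ?thesis using e by simp
    qed
    then show "\<exists>N. \<forall>n\<ge>N. norm (l2norm \<mu> (\<lambda>x. g x - S n x) - 0) < e" by blast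
  qed
  with gL2 show ?thesis by blast
qed

section \<open>Orthonormal series\<close>

lemma l2_sums_L2: "l2_sums \<mu> F g \<Longrightarrow> g \<in> L2 \<mu>"
  by (simp add: l2_sums_def)

lemma l2_sums_scale:
  assumes "l2_sums \<mu> F f"
  shows "l2_sums \<mu> (\<lambda>j x. a * F j x) (\<lambda>x. a * f x)"
proof -
  have "l2norm \<mu> (\<lambda>x. a * f x - (\<Sum>j<n. a * F j x)) = cmod a * l2norm \<mu> (\<lambda>x. f x - (\<Sum>j<n. F j x))" for n
    by (simp flip: l2norm_scale add: sum_distrib_left right_diff_distrib)
  then show ?thesis
    using assms tendsto_mult_left[of "\<lambda>n. l2norm \<mu> (\<lambda>x. f x - (\<Sum>j<n. F j x))" 0 sequentially "cmod a"]
    by (auto simp: l2_sums_def L2_scale)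
qed

lemma l2_sums_add:
  assumes f: "l2_sums \<mu> F f" and g: "l2_sums \<mu> G g"
    and F: "\<And>j. F j \<in> L2 \<mu>" and G: "\<And>j. G j \<in> L2 \<mu>"
  shows "l2_sums \<mu> (\<lambda>j x. F j x + G j x) (\<lambda>x. f x + g x)"
proof -
  have "(\<lambda>n. l2norm \<mu> (\<lambda>x. f x - (\<Sum>j<n. F j x)) + l2norm \<mu> (\<lambda>x. g x - (\<Sum>j<n. G j x))) \<longlonglongrightarrow> 0 + 0"
    using f g unfolding l2_sums_def by (intro tendsto_add) auto
  moreover have "l2norm \<mu> (\<lambda>x. f x + g x - (\<Sum>j<n. F j x + G j x))
      \<le> l2norm \<mu> (\<lambda>x. f x - (\<Sum>j<n. F j x)) + l2norm \<mu> (\<lambda>x. g x - (\<Sum>j<n. G j x))" for n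
    using l2norm_triangle[OF L2_diff[OF l2_sums_L2[OF f] L2_sum[of "{..<n}", OF F]]
        L2_diff[OF l2_sums_L2[OF g] L2_sum[of "{..<n}", OF G]]]
    by (simp add: sum.distrib algebra_simps)
  ultimately have "(\<lambda>n. l2norm \<mu> (\<lambda>x. f x + g x - (\<Sum>j<n. F j x + G j x))) \<longlonglongrightarrow> 0"
    by - (rule Lim_null_comparison[OF always_eventually], simp_all)
  then show ?thesis using f g by (auto simp: l2_sums_def L2_add)
qed

lemma l2_sums_diff:
  assumes "l2_sums \<mu> F f" "l2_sums \<mu> G g" "\<And>j. F j \<in> L2 \<mu>" "\<And>j. G j \<in> L2 \<mu>"
  shows "l2_sums \<mu> (\<lambda>j x. F j x - G j x) (\<lambda>x. f x - g x)"
  using l2_sums_add[OF assms(1) l2_sums_scale[OF assms(2), of "-1"]] assms(3,4) by (simp add: L2_scale[of _ _ "-1", simplified])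

lemma l2_sums_finite:
  assumes S: "finite S" and F: "\<And>j. F j \<in> L2 \<mu>" and zero: "\<And>j x. j \<notin> S \<Longrightarrow> F j x = 0"
  shows "l2_sums \<mu> F (\<lambda>x. \<Sum>j\<in>S. F j x)"
proof -
  obtain N where N: "S \<subseteq> {..<N}" using S by (meson finite_nat_bounded)
  have "l2norm \<mu> (\<lambda>x. (\<Sum>j\<in>S. F j x) - (\<Sum>j<n. F j x)) = 0" if "n \<ge> N" for n
  proof -
    have "(\<Sum>j\<in>S. F j x) = (\<Sum>j<n. F j x)" for x
      using N that zero by (intro sum.mono_neutral_left) auto
    then show ?thesis by (simp add: l2norm_def)
  qed
  then have "(\<lambda>n. l2norm \<mu> (\<lambda>x. (\<Sum>j\<in>S. F j x) - (\<Sum>j<n. F j x))) \<longlonglongrightarrow> 0"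
    by (intro tendsto_eventually) (auto simp: eventually_sequentially)
  then show ?thesis by (simp add: l2_sums_def L2_sum F)
qed

text \<open>Cauchy-Schwarz makes pairing with a fixed \<open>u\<close> continuous, so it may be
  applied term by term.\<close>

lemma l2_sums_l2inner:
  assumes g: "l2_sums \<mu> F g" and F: "\<And>j. F j \<in> L2 \<mu>" and u: "u \<in> L2 \<mu>"
  shows "(\<lambda>j. l2inner \<mu> u (F j)) sums l2inner \<mu> u g"
proof -
  have lim: "(\<lambda>n. l2norm \<mu> u * l2norm \<mu> (\<lambda>x. g x - (\<Sum>j<n. F j x))) \<longlonglongrightarrow> l2norm \<mu> u * 0"
    using g unfolding l2_sums_def by (intro tendsto_mult_left) auto
  have "cmod (l2inner \<mu> u g - (\<Sum>j<n. l2inner \<mu> u (F j)))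
      \<le> l2norm \<mu> u * l2norm \<mu> (\<lambda>x. g x - (\<Sum>j<n. F j x))" for n
    using l2_Cauchy_Schwarz[OF u L2_diff[OF l2_sums_L2[OF g] L2_sum[of "{..<n}", OF F]]]
    by (simp add: l2inner_diff_right l2inner_sum_right L2_sum F u l2_sums_L2[OF g])
  then have "(\<lambda>n. l2inner \<mu> u g - (\<Sum>j<n. l2inner \<mu> u (F j))) \<longlonglongrightarrow> 0"
    using lim by - (rule Lim_null_comparison[OF always_eventually], simp_all)
  from tendsto_diff[OF tendsto_const[of "l2inner \<mu> u g"] this]
  show ?thesis by (simp add: sums_def)
qed

text \<open>The sequence is not asked to be complete, since eigenfunctions vanishing at
  \<open>p\<close> are left out of it. Hence \<open>expands c g\<close> carries real information:
  \<open>g\<close> lies in the closed span of the sequence.\<close>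

locale orthonormal_seq =
  fixes \<mu> :: "'a measure" and \<Phi> :: "nat \<Rightarrow> 'a \<Rightarrow> complex"
  assumes Phi_L2: "\<Phi> j \<in> L2 \<mu>"
    and ortho: "l2inner \<mu> (\<Phi> i) (\<Phi> j) = (if i = j then 1 else 0)"
begin

abbreviation expands :: "(nat \<Rightarrow> complex) \<Rightarrow> ('a \<Rightarrow> complex) \<Rightarrow> bool" where
  "expands c \<equiv> l2_sums \<mu> (\<lambda>j x. c j * \<Phi> j x)"

lemma term_L2: "(\<lambda>x. c j * \<Phi> j x) \<in> L2 \<mu>"
  by (intro L2_scale Phi_L2)

lemma l2norm_sum:
  assumes "finite S"
  shows "(l2norm \<mu> (\<lambda>x. \<Sum>j\<in>S. c j * \<Phi> j x))\<^sup>2 = (\<Sum>j\<in>S. (cmod (c j))\<^sup>2)"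
proof -
  let ?f = "\<lambda>x. \<Sum>j\<in>S. c j * \<Phi> j x"
  have f: "?f \<in> L2 \<mu>" by (intro L2_sum term_L2)
  have coeff: "l2inner \<mu> (\<Phi> j) ?f = (if j \<in> S then cnj (c j) else 0)" for j
  proof -
    have "l2inner \<mu> (\<Phi> j) ?f = (\<Sum>i\<in>S. cnj (c i) * (if j = i then 1 else 0))"
      by (simp add: l2inner_sum_right term_L2 Phi_L2 l2inner_scale_right ortho)
    also have "\<dots> = (\<Sum>i\<in>S. if j = i then cnj (c i) else 0)" by (intro sum.cong) auto
    finally show ?thesis using assms by simp
  qed
  have "l2inner \<mu> ?f ?f = (\<Sum>j\<in>S. l2inner \<mu> ?f (\<lambda>x. c j * \<Phi> j x))"
    by (rule l2inner_sum_right[OF term_L2 f])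
  also have "\<dots> = (\<Sum>j\<in>S. cnj (c j) * cnj (l2inner \<mu> (\<Phi> j) ?f))"
    by (simp add: l2inner_scale_right l2inner_cnj)
  also have "\<dots> = (\<Sum>j\<in>S. of_real ((cmod (c j))\<^sup>2))"
    by (intro sum.cong) (auto simp only: coeff if_True complex_norm_square complex_cnj_cnj mult.commute)
  finally have "complex_of_real ((l2norm \<mu> ?f)\<^sup>2) = of_real (\<Sum>j\<in>S. (cmod (c j))\<^sup>2)"
    by (simp only: l2inner_self of_real_sum)
  then show ?thesis by (simp only: of_real_eq_iff)
qed

lemma expands_coeff:
  assumes "expands c g"
  shows "l2inner \<mu> g (\<Phi> j) = c j"
proof -
  have "(\<lambda>i. l2inner \<mu> (\<Phi> j) (\<lambda>x. c i * \<Phi> i x)) sums l2inner \<mu> (\<Phi> j) g"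
    using assms by (rule l2_sums_l2inner) (rule term_L2 Phi_L2)+
  moreover have "(\<lambda>i. l2inner \<mu> (\<Phi> j) (\<lambda>x. c i * \<Phi> i x)) = (\<lambda>i. if i = j then cnj (c i) else 0)"
    by (auto simp: l2inner_scale_right ortho)
  ultimately have "l2inner \<mu> (\<Phi> j) g = cnj (c j)"
    using sums_unique2[OF _ sums_single[of j "\<lambda>i. cnj (c i)"]] by simp
  then show ?thesis by (metis complex_cnj_cnj l2inner_cnj)
qed

lemma expands_l2inner:
  assumes "expands c g" "u \<in> L2 \<mu>"
  shows "(\<lambda>j. cnj (c j) * l2inner \<mu> u (\<Phi> j)) sums l2inner \<mu> u g"
  using l2_sums_l2inner[OF assms(1) _ assms(2)] by (simp add: term_L2 l2inner_scale_right)

text \<open>Parseval's identity, from pairing \<open>g\<close> with its own expansion.\<close>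

lemma expands_l2norm:
  assumes "expands c g"
  shows "(\<lambda>j. (cmod (c j))\<^sup>2) sums (l2norm \<mu> g)\<^sup>2"
proof -
  have "(\<lambda>j. cnj (c j) * c j) sums of_real ((l2norm \<mu> g)\<^sup>2)"
    using expands_l2inner[OF assms l2_sums_L2[OF assms]]
    by (simp only: expands_coeff[OF assms] l2inner_self)
  then have "(\<lambda>j. complex_of_real ((cmod (c j))\<^sup>2)) sums of_real ((l2norm \<mu> g)\<^sup>2)"
    by (simp only: complex_norm_square mult.commute)
  then show ?thesis by (simp only: sums_of_real_iff)
qed

text \<open>Orthonormality turns the squared norm of a difference of partial sums into a block of
  the series of squares, so square-summability is the Cauchy condition of
  \<open>L2_complete\<close>.\<close>

lemma expands_exists:
  assumes "summable (\<lambda>j. (cmod (c j))\<^sup>2)"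
  obtains g where "expands c g"
proof -
  define S where "S n x = (\<Sum>j<n. c j * \<Phi> j x)" for n x
  have S: "S n \<in> L2 \<mu>" for n unfolding S_def by (intro L2_sum term_L2)
  have "\<exists>g\<in>L2 \<mu>. (\<lambda>n. l2norm \<mu> (\<lambda>x. g x - S n x)) \<longlonglongrightarrow> 0"
  proof (rule L2_complete[OF S])
    fix e :: real assume e: "0 < e"
    then obtain N where N: "\<And>m n. m \<ge> N \<Longrightarrow> norm (\<Sum>j=m..<n. (cmod (c j))\<^sup>2) < e\<^sup>2"
      using assms unfolding summable_Cauchy by (meson zero_less_power)
    have one: "l2norm \<mu> (\<lambda>x. S m x - S n x) \<le> e" if "N \<le> n" "n \<le> m" for m n
    proof -
      have "S m x - S n x = (\<Sum>j=n..<m. c j * \<Phi> j x)" for x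
        unfolding S_def lessThan_atLeast0 using that
        by (subst sum.atLeastLessThan_concat[of 0 n m, symmetric]) auto
      then have "(l2norm \<mu> (\<lambda>x. S m x - S n x))\<^sup>2 = (\<Sum>j=n..<m. (cmod (c j))\<^sup>2)"
        by (simp add: l2norm_sum)
      also have "\<dots> \<le> e\<^sup>2" using N[of n m] that by simp
      finally show ?thesis by (rule power2_le_imp_le) (use e in simp)
    qed
    have "l2norm \<mu> (\<lambda>x. S m x - S n x) \<le> e" if "m \<ge> N" "n \<ge> N" for m n
      using one[of n m] one[of m n] that l2norm_diff_commute[of \<mu> "S m" "S n"]
      by (cases "n \<le> m") auto
    then show "\<exists>N. \<forall>m\<ge>N. \<forall>n\<ge>N. l2norm \<mu> (\<lambda>x. S m x - S n x) \<le> e" by blast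
  qed
  then show ?thesis using that by (auto simp: l2_sums_def S_def)
qed

lemma expands_add:
  assumes "expands c f" "expands d g"
  shows "expands (\<lambda>j. c j + d j) (\<lambda>x. f x + g x)"
  using l2_sums_add[OF assms] by (simp add: term_L2 distrib_right)

lemma expands_diff:
  assumes "expands c f" "expands d g"
  shows "expands (\<lambda>j. c j - d j) (\<lambda>x. f x - g x)"
  using l2_sums_diff[OF assms] by (simp add: term_L2 left_diff_distrib)

lemma expands_scale:
  assumes "expands c f"
  shows "expands (\<lambda>j. a * c j) (\<lambda>x. a * f x)"
  using l2_sums_scale[OF assms, of a] by (simp add: mult.assoc)

text \<open>Puts a quasimode into the same form as an infinite expansion, so that the two can be
  subtracted coefficient by coefficient.\<close>

lemma expands_finite:
  assumes "finite S"
  shows "expands (\<lambda>j. if j \<in> S then c j else 0) (\<lambda>x. \<Sum>j\<in>S. c j * \<Phi> j x)"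
  using l2_sums_finite[of S "\<lambda>j x. (if j \<in> S then c j else 0) * \<Phi> j x" \<mu>, OF assms]
  by (simp add: L2_scale Phi_L2 cong: sum.cong)

end

section \<open>Weighted sums under Weyl's law\<close>

text \<open>Meant for \<open>s\<close> and \<open>t\<close> the square roots of consecutive partial
  sums of the weights; then \<open>(t - s) * (t + s)\<close> is the weight just added.\<close>

lemma telescoping_bound:
  fixes s t :: real
  assumes "0 < s" "s \<le> t"
  shows "(t - s) * (t + s) / (t * t * t) \<le> 2 * (1 / s - 1 / t)"
proof -
  have "(t + s) / (t * t * t) \<le> (2 * t) / (t * t * t)" using assms by (intro divide_right_mono) auto
  also have "\<dots> = 2 / (t * t)" using assms by simp
  also have "\<dots> \<le> 2 / (s * t)" using assms by (intro divide_left_mono) auto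
  finally have "(t - s) * ((t + s) / (t * t * t)) \<le> (t - s) * (2 / (s * t))"
    using assms by (intro mult_left_mono) auto
  also have "\<dots> = 2 * (1 / s - 1 / t)" using assms by (simp add: field_simps)
  finally show ?thesis by simp
qed

text \<open>Isolates the real-variable consequences of Weyl's law. Energies may be negative or zero,
  so the estimates below treat small energies separately.\<close>

locale weyl_weights =
  fixes w E :: "nat \<Rightarrow> real"
  assumes w_pos: "0 < w j"
    and E_strict_mono: "strict_mono E"
    and weyl_law: "(\<lambda>x. (\<Sum>j\<in>{j. E j \<le> x}. w j) - x / (4 * pi)) \<in> O(\<lambda>x. x powr (1/2))"
begin

lemma w_nonneg: "0 \<le> w j"
  using w_pos[of j] by simp

definition N :: "real \<Rightarrow> real" where "N x = (\<Sum>j\<in>{j. E j \<le> x}. w j)"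

lemma weyl_bound:
  obtains C X where "0 < C" "1 \<le> X" "\<And>x. x \<ge> X \<Longrightarrow> \<bar>N x - x / (4 * pi)\<bar> \<le> C * sqrt x"
proof -
  obtain C where C: "C > 0" "\<forall>\<^sub>F x in at_top. norm (N x - x / (4 * pi)) \<le> C * norm (x powr (1/2))"
    using weyl_law unfolding N_def by (rule landau_o.bigE)
  then obtain X where X: "\<And>x. x \<ge> X \<Longrightarrow> norm (N x - x / (4 * pi)) \<le> C * norm (x powr (1/2))"
    unfolding eventually_at_top_linorder by blast
  then have "\<bar>N x - x / (4 * pi)\<bar> \<le> C * sqrt x" if "x \<ge> max X 1" for x
    using X[of x] that by (simp add: powr_half_sqrt)
  with C(1) show ?thesis by (intro that[of C "max X 1"]) auto
qed

text \<open>A sum over an infinite set is 0 by convention. With infinitely many energies below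
  \<open>x\<close>, \<open>N\<close> would vanish from \<open>x\<close> on, and Weyl's law would
  make \<open>y / (4 * pi)\<close> of order \<open>sqrt y\<close>.\<close>

lemma finite_below: "finite {j. E j \<le> x}"
proof (rule ccontr)
  assume inf: "infinite {j. E j \<le> x}"
  have N0: "N y = 0" if "y \<ge> x" for y
  proof -
    have "infinite {j. E j \<le> y}"
      using inf by (rule infinite_super[rotated]) (use that in auto)
    then show ?thesis by (simp add: N_def)
  qed
  obtain C X where C: "0 < C" "1 \<le> X" "\<And>x. x \<ge> X \<Longrightarrow> \<bar>N x - x / (4 * pi)\<bar> \<le> C * sqrt x"
    using weyl_bound by blast
  \<comment> \<open>Evaluating at \<open>s\<^sup>2\<close> makes the contradiction a linear
    inequality in \<open>s\<close>, violated once \<open>s\<close> exceeds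
    \<open>4 * pi * C\<close>.\<close>
  define s where "s = 4 * pi * C + max X (max x 1)"
  have s: "s > 4 * pi * C" "s \<ge> max X (max x 1)" "s \<ge> 1"
    using C(2) mult_pos_pos[OF _ C(1), of "4 * pi"] pi_gt_zero unfolding s_def by linarith+
  have "s * 1 \<le> s * s" using s by (intro mult_left_mono) auto
  then have "s\<^sup>2 \<ge> X" "s\<^sup>2 \<ge> x" using s by (auto simp: power2_eq_square intro: order_trans[of _ s])
  then have "s\<^sup>2 / (4 * pi) \<le> C * s"
    using C(3)[of "s\<^sup>2"] N0[of "s\<^sup>2"] s by simp
  then have "s * s \<le> (4 * pi * C) * s" by (simp add: field_simps power2_eq_square)
  then have "s \<le> 4 * pi * C" using s by (simp add: mult_le_cancel_right)
  with s show False by simp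
qed

lemma N_nonneg: "0 \<le> N x"
  unfolding N_def by (intro sum_nonneg w_nonneg)

lemma sum_le_N:
  assumes "\<And>j. j \<in> S \<Longrightarrow> E j \<le> x"
  shows "sum w S \<le> N x"
  unfolding N_def using assms by (intro sum_mono2 finite_below w_nonneg) auto

lemma N_linear:
  obtains C where "1 \<le> C" "\<And>x. x \<ge> 1 \<Longrightarrow> N x \<le> C * x"
proof -
  obtain C X where C: "0 < C" "1 \<le> X" "\<And>x. x \<ge> X \<Longrightarrow> \<bar>N x - x / (4 * pi)\<bar> \<le> C * sqrt x"
    using weyl_bound by blast
  have large: "N x \<le> (C + 1) * x" if "x \<ge> X" for x
  proof -
    have "sqrt x \<le> x" using that C(2) by (intro real_le_lsqrt) (auto simp: power2_eq_square)
    then have "C * sqrt x \<le> C * x" using C by simp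
    moreover have "x / (4 * pi) \<le> x" using that C(2) pi_gt3 by (simp add: divide_le_eq)
    ultimately show ?thesis using C(3)[OF that] by (simp add: algebra_simps)
  qed
  show ?thesis
  \<comment> \<open>Below the threshold \<open>X\<close> of Weyl's law monotonicity bounds
    \<open>N\<close> by \<open>N X\<close>, which is therefore added to the constant.\<close>
  proof (rule that[of "C + 1 + N X"])
    show "1 \<le> C + 1 + N X" using C N_nonneg[of X] by simp
    fix x :: real assume x: "x \<ge> 1"
    have NX: "N X \<le> N X * x" using mult_left_mono[OF x N_nonneg[of X]] by simp
    show "N x \<le> (C + 1 + N X) * x"
    proof (cases "x \<ge> X")
      case True
      then show ?thesis using large[OF True] mult_nonneg_nonneg[OF N_nonneg[of X], of x] x by (simp add: algebra_simps)
    next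
      case False
      then have "N x \<le> N X" unfolding N_def[of x] by (intro sum_le_N) auto
      then show ?thesis using NX C x by (simp add: algebra_simps add_increasing)
    qed
  qed
qed

text \<open>Subtracts Weyl's law at \<open>x - sqrt x\<close> from that at
  \<open>x + sqrt x\<close>. The main terms differ by \<open>sqrt x / (2 * pi)\<close>, which has
  the order of the errors, so a shorter window would gain nothing in this argument.\<close>

lemma window_bound:
  obtains C X where "0 < C" "1 \<le> X" "\<And>x. x \<ge> X \<Longrightarrow> sum w {j. \<bar>E j - x\<bar> < sqrt x} \<le> C * sqrt x"
proof -
  obtain C X where C: "0 < C" "1 \<le> X" "\<And>x. x \<ge> X \<Longrightarrow> \<bar>N x - x / (4 * pi)\<bar> \<le> C * sqrt x"
    using weyl_bound by blast
  \<comment> \<open>From \<open>x \<ge> 4 * X\<close> follows \<open>sqrt x \<le> x / 2\<close>,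
    which keeps both ends of the window above \<open>X\<close>. In the constant,
    \<open>2 * C\<close> and \<open>C\<close> are the errors at the upper and the lower end, and 1
    covers the main terms.\<close>
  have "sum w {j. \<bar>E j - x\<bar> < sqrt x} \<le> (3 * C + 1) * sqrt x" if x: "x \<ge> 4 * X" for x
  proof -
    have x4: "x \<ge> 4" using x C(2) by simp
    have "sqrt 4 \<le> sqrt x" using x4 by (simp only: real_sqrt_le_iff)
    then have s2: "2 \<le> sqrt x" by simp
    have "sqrt x * 2 \<le> sqrt x * sqrt x" using s2 x4 by (intro mult_left_mono) auto
    then have sx: "2 * sqrt x \<le> x" using x4 by simp
    let ?a = "x - sqrt x" and ?b = "x + sqrt x"
    have ab: "?a \<ge> X" "?b \<ge> X" "?b \<le> 4 * x" "?a \<le> x"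
      using x sx s2 C(2) by auto
    have "sum w {j. \<bar>E j - x\<bar> < sqrt x} + N ?a = sum w ({j. \<bar>E j - x\<bar> < sqrt x} \<union> {j. E j \<le> ?a})"
      unfolding N_def
      by (intro sum.union_disjoint[symmetric] finite_below finite_subset[OF _ finite_below[of ?b]]) auto
    also have "\<dots> \<le> N ?b" using s2 by (intro sum_le_N) auto
    finally have "sum w {j. \<bar>E j - x\<bar> < sqrt x} \<le> N ?b - N ?a" by simp
    also have "\<dots> \<le> C * sqrt ?b + C * sqrt ?a + (?b / (4 * pi) - ?a / (4 * pi))"
      using C(3)[OF ab(1)] C(3)[OF ab(2)] by linarith
    also have "?b / (4 * pi) - ?a / (4 * pi) \<le> sqrt x"
    proof -
      have "?b / (4 * pi) - ?a / (4 * pi) = sqrt x / (2 * pi)" by (simp add: field_simps)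
      also have "\<dots> \<le> sqrt x / 1" using pi_gt3 x4 by (intro divide_left_mono) auto
      finally show ?thesis by simp
    qed
    also have "C * sqrt ?b \<le> C * (2 * sqrt x)"
      using real_sqrt_le_mono[OF ab(3)] C(1) by (simp add: real_sqrt_mult)
    also have "C * sqrt ?a \<le> C * sqrt x" using real_sqrt_le_mono[OF ab(4)] C(1) by simp
    finally show ?thesis by (simp add: algebra_simps)
  qed
  then show ?thesis using C by (intro that[of "3 * C + 1" "4 * X"]) auto
qed

lemma E_at_top: "filterlim E at_top sequentially"
  unfolding filterlim_at_top
proof
  fix Z
  have "eventually (\<lambda>j. j \<notin> {j. E j \<le> Z}) sequentially"
    using finite_below[of Z] by (simp add: eventually_cofinite flip: cofinite_eq_sequentially)
  then show "\<forall>\<^sub>F j in sequentially. Z \<le> E j" by eventually_elim auto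
qed

lemma N_E: "N (E j) = sum w {..j}"
  unfolding N_def using E_strict_mono by (simp add: strict_mono_less_eq lessThan_def atMost_def)

text \<open>By Weyl's law \<open>E\<^sub>j\<close> dominates the partial sum \<open>n\<^sub>j\<close> of the weights, and
  \<open>(n\<^sub>j - n\<^sub>j\<^sub>-\<^sub>1) n\<^sub>j\<^sup>-\<^sup>3\<^sup>/\<^sup>2\<close> is dominated by the increments of \<open>-2 n\<^sub>j\<^sup>-\<^sup>1\<^sup>/\<^sup>2\<close>.\<close>

lemma summable_weights: "summable (\<lambda>j. w j / (E j * sqrt (E j)))"
proof -
  obtain C where C: "1 \<le> C" "\<And>x. x \<ge> 1 \<Longrightarrow> N x \<le> C * x"
    using N_linear by blast
  define n where "n j = sum w {..j}" for j
  have n_pos: "n j > 0" for j unfolding n_def by (intro sum_pos w_pos) auto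
  have n_Suc: "n (Suc j) = n j + w (Suc j)" for j unfolding n_def by simp
  have n_mono: "n i \<le> n j" if "i \<le> j" for i j
    unfolding n_def using that by (intro sum_mono2 w_nonneg) auto
  have "decseq (\<lambda>j. 1 / sqrt (n j))"
    unfolding decseq_def by (auto intro!: divide_left_mono mult_pos_pos real_sqrt_le_mono n_mono simp: n_pos)
  moreover have "0 \<le> 1 / sqrt (n j)" for j using n_pos[of j] by simp
  ultimately obtain L where "(\<lambda>j. 1 / sqrt (n j)) \<longlonglongrightarrow> L"
    using decseq_convergent by blast
  then have tele: "summable (\<lambda>j. C * sqrt C * (2 * (1 / sqrt (n j) - 1 / sqrt (n (Suc j)))))"
    by (intro summable_mult telescope_summable')
  have "\<forall>\<^sub>F j in sequentially. norm (w (Suc j) / (E (Suc j) * sqrt (E (Suc j))))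
      \<le> C * sqrt C * (2 * (1 / sqrt (n j) - 1 / sqrt (n (Suc j))))"
    using filterlim_compose[OF E_at_top filterlim_Suc, unfolded filterlim_at_top, rule_format, of 1]
  proof eventually_elim
    case (elim j)
    let ?e = "E (Suc j)" and ?t = "sqrt (n (Suc j))" and ?s = "sqrt (n j)"
    have st: "0 < ?s" "?s \<le> ?t" "0 < ?t" using n_pos[of j] n_pos[of "Suc j"] n_mono[of j "Suc j"] by auto
    have wst: "w (Suc j) = ?t\<^sup>2 - ?s\<^sup>2" using n_pos[of j] n_pos[of "Suc j"] n_Suc[of j] by simp
    have nC: "n (Suc j) \<le> C * ?e" using C(2)[OF elim] N_E[of "Suc j"] by (simp add: n_def)
    have "?t \<le> sqrt C * sqrt ?e" using real_sqrt_le_mono[OF nC] by (simp add: real_sqrt_mult)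
    then have "n (Suc j) * ?t \<le> (C * ?e) * (sqrt C * sqrt ?e)"
      using nC st n_pos[of "Suc j"] elim C(1) by (intro mult_mono) auto
    then have "w (Suc j) / (C * sqrt C * (?e * sqrt ?e)) \<le> w (Suc j) / (n (Suc j) * ?t)"
      using w_nonneg n_pos[of "Suc j"] elim C(1)
      by (intro divide_left_mono mult_pos_pos) (auto simp: mult_ac)
    also have "\<dots> = (?t - ?s) * (?t + ?s) / (?t * ?t * ?t)"
      using n_pos[of "Suc j"] by (simp add: wst power2_eq_square algebra_simps)
    also have "\<dots> \<le> 2 * (1 / ?s - 1 / ?t)"
      by (rule telescoping_bound[OF st(1,2)])
    finally have "w (Suc j) / (?e * sqrt ?e) / (C * sqrt C) \<le> 2 * (1 / ?s - 1 / ?t)"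
      by (simp add: field_simps)
    then have "w (Suc j) / (?e * sqrt ?e) \<le> C * sqrt C * (2 * (1 / ?s - 1 / ?t))"
      using C(1) by (subst (asm) pos_divide_le_eq) (auto simp: mult_ac)
    then show ?case using elim w_nonneg by simp
  qed
  then have "summable (\<lambda>j. w (Suc j) / (E (Suc j) * sqrt (E (Suc j))))"
    using tele by (rule summable_comparison_test_ev)
  then show ?thesis
    using summable_Suc_iff[of "\<lambda>j. w j / (E j * sqrt (E j))"] by simp
qed

end

section \<open>Bounds for a single resolvent term\<close>

lemma mult_sqrt_nonneg: "0 \<le> x * sqrt x"
  \<comment> \<open>\<open>sqrt\<close> is an odd function on the reals, so for negative
    \<open>x\<close> both factors are negative.\<close>
  by (cases "0 \<le> x") (auto intro: mult_nonpos_nonpos)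

text \<open>The left side is the right side times \<open>sqrt (l / e)\<close>, which is below 1. The
  exponent 3/2 of \<open>e\<close> is the one for which \<open>summable_weights\<close> gives
  convergence.\<close>

lemma inverse_square_far:
  fixes e l :: real
  assumes l: "1 \<le> l" and far: "2 * l < e"
  shows "l / e\<^sup>2 \<le> sqrt l / (e * sqrt e)"
proof -
  define s t where "s = sqrt l" and "t = sqrt e"
  have st: "0 < s" "s \<le> t" "0 < t" and le: "l = s\<^sup>2" "e = t\<^sup>2"
    unfolding s_def t_def using assms by auto
  have "s\<^sup>2 / (t\<^sup>2)\<^sup>2 = (s / t ^ 3) * (s / t)" using st by (simp add: field_simps eval_nat_numeral)
  also have "\<dots> \<le> (s / t ^ 3) * 1" using st by (intro mult_left_mono) auto
  also have "\<dots> = sqrt l / (e * sqrt e)" using st unfolding le by (simp add: eval_nat_numeral)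
  finally show ?thesis unfolding le .
qed

text \<open>One summand per regime. Inside the window only the gap \<open>g\<close> helps. Up to
  \<open>2 * l\<close> both fractions are at most \<open>1 / sqrt l\<close>, except that
  \<open>e / (e\<^sup>2 + 1)\<close> is merely bounded by 1 when \<open>e \<le> sqrt l\<close>.
  Beyond \<open>2 * l\<close> the fractions cancel to order \<open>l / e\<^sup>2\<close>.\<close>

lemma resolvent_term_bound:
  fixes e l g :: real
  assumes l: "1 \<le> l" and g: "0 < g" "g \<le> \<bar>e - l\<bar>"
  shows "\<bar>1 / (e - l) - e / (e\<^sup>2 + 1)\<bar> \<le> of_bool (\<bar>e - l\<bar> < sqrt l) / g
      + 2 * of_bool (e \<le> 2 * l) / sqrt l + of_bool (e \<le> sqrt l) + 4 * sqrt l / (e * sqrt e)"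
proof (cases "e \<le> 2 * l")
  case True
  have "\<bar>1 / (e - l)\<bar> \<le> of_bool (\<bar>e - l\<bar> < sqrt l) / g + 1 / sqrt l"
  proof (cases "\<bar>e - l\<bar> < sqrt l")
    case True
    have "\<bar>1 / (e - l)\<bar> \<le> 1 / g" using g by (simp add: frac_le)
    then show ?thesis using True l by (simp add: add_increasing2)
  next
    case False
    then show ?thesis using l by (simp add: frac_le)
  qed
  moreover have "\<bar>e / (e\<^sup>2 + 1)\<bar> \<le> of_bool (e \<le> sqrt l) + 1 / sqrt l"
  proof (cases "e \<le> sqrt l")
    case True
    have "\<bar>e\<bar> \<le> e\<^sup>2 + 1" using sum_squares_bound[of "\<bar>e\<bar>" 1] by auto
    moreover have "0 < e\<^sup>2 + 1" by (simp add: add_nonneg_pos)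
    ultimately have "\<bar>e / (e\<^sup>2 + 1)\<bar> \<le> 1" by (simp add: abs_divide)
    then show ?thesis using True l by (simp add: add_increasing2)
  next
    case False
    then have e: "0 < e" "sqrt l \<le> e" "0 < sqrt l" using l by (auto intro: less_le_trans[of 0 "sqrt l"])
    have "\<bar>e / (e\<^sup>2 + 1)\<bar> = e / (e\<^sup>2 + 1)" using e(1) by simp
    also have "\<dots> \<le> e / e\<^sup>2" using e(1) by (intro divide_left_mono) (auto simp: add_pos_pos)
    also have "\<dots> = 1 / e" by (simp add: power2_eq_square)
    also have "\<dots> \<le> 1 / sqrt l" using e by (simp add: frac_le)
    finally show ?thesis using False by simp
  qed
  moreover have "0 \<le> 4 * sqrt l / (e * sqrt e)"
    using l mult_sqrt_nonneg[of e] by simp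
  ultimately show ?thesis using True abs_triangle_ineq4[of "1 / (e - l)" "e / (e\<^sup>2 + 1)"] by simp
next
  case False
  then have e: "2 * l < e" "1 < e" "0 < e - l" using l by auto
  have e2: "0 < e\<^sup>2 + 1" by (simp add: add_nonneg_pos)
  have eq: "1 / (e - l) - e / (e\<^sup>2 + 1) = (1 + l * e) / ((e - l) * (e\<^sup>2 + 1))"
    using e e2 by (simp add: field_simps power2_eq_square)
  have "\<bar>1 / (e - l) - e / (e\<^sup>2 + 1)\<bar> = (1 + l * e) / ((e - l) * (e\<^sup>2 + 1))"
    unfolding eq using e e2 l by simp
  also have "\<dots> \<le> (2 * (l * e)) / ((e / 2) * e\<^sup>2)"
  proof (rule frac_le)
    have "1 * 1 \<le> l * e" using l e by (intro mult_mono) auto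
    then show "1 + l * e \<le> 2 * (l * e)" by linarith
    show "e / 2 * e\<^sup>2 \<le> (e - l) * (e\<^sup>2 + 1)" using e by (intro mult_mono) auto
  qed (use e l in auto)
  also have "\<dots> = 4 * (l / e\<^sup>2)" using e by (simp add: field_simps)
  also have "\<dots> \<le> 4 * (sqrt l / (e * sqrt e))" using inverse_square_far[OF l e(1)] by simp
  finally have "\<bar>1 / (e - l) - e / (e\<^sup>2 + 1)\<bar> \<le> 4 * sqrt l / (e * sqrt e)"
    by (simp only: times_divide_eq_right)
  moreover have "0 \<le> of_bool (\<bar>e - l\<bar> < sqrt l) / g" using g by simp
  moreover have "0 \<le> 2 * of_bool (e \<le> 2 * l) / sqrt l" using l by simp
  moreover have "0 \<le> (of_bool (e \<le> sqrt l) :: real)" by simp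
  ultimately show ?thesis by linarith
qed

text \<open>The same regimes; beyond \<open>2 * l\<close> the square decays fast enough without a
  cancelling term.\<close>

lemma resolvent_square_bound:
  fixes e l g :: real
  assumes l: "1 \<le> l" and g: "0 < g" "g \<le> \<bar>e - l\<bar>"
  shows "1 / (e - l)\<^sup>2 \<le> of_bool (\<bar>e - l\<bar> < sqrt l) / g\<^sup>2
      + of_bool (e \<le> 2 * l) / l + 4 * sqrt l / (e * sqrt e)"
proof -
  have nonneg: "0 \<le> 4 * sqrt l / (e * sqrt e)"
    using l mult_sqrt_nonneg[of e] by simp
  consider "\<bar>e - l\<bar> < sqrt l" | "sqrt l \<le> \<bar>e - l\<bar>" "e \<le> 2 * l" | "2 * l < e" by linarith
  then show ?thesis
  proof cases
    case 1
    have "g\<^sup>2 \<le> (e - l)\<^sup>2" using g by (simp add: abs_le_square_iff[symmetric])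
    then have "1 / (e - l)\<^sup>2 \<le> 1 / g\<^sup>2" using g by (simp add: frac_le)
    then show ?thesis using 1 nonneg l by (simp add: add_increasing2)
  next
    case 2
    have "(sqrt l)\<^sup>2 \<le> \<bar>e - l\<bar>\<^sup>2" using 2 l by (intro power_mono) auto
    then have "1 / (e - l)\<^sup>2 \<le> 1 / l" using l by (simp add: frac_le)
    then show ?thesis using 2 nonneg g by (simp add: add_increasing2)
  next
    case 3
    have "(e / 2)\<^sup>2 \<le> (e - l)\<^sup>2" using 3 l by (intro power_mono) auto
    then have "1 / (e - l)\<^sup>2 \<le> 1 / (e / 2)\<^sup>2" using 3 l by (intro frac_le) auto
    also have "\<dots> \<le> 4 * (l / e\<^sup>2)" using 3 l by (simp add: field_simps)
    also have "\<dots> \<le> 4 * (sqrt l / (e * sqrt e))" using inverse_square_far[OF l 3] by simp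
    finally show ?thesis using l g by (simp add: add_increasing)
  qed
qed

text \<open>The difference is \<open>(1 + l * e) / ((e - l) * (e\<^sup>2 + 1))\<close>, and the
  hypothesis makes \<open>e - l\<close> grow linearly in \<open>e\<close>, which absorbs
  \<open>l * e\<close>. This cruder bound serves convergence, continuity and membership in the
  domain.\<close>

lemma resolvent_term_majorant:
  fixes e l \<kappa> :: real
  assumes \<kappa>: "0 < \<kappa>" "\<kappa> * (1 + \<bar>e\<bar>) \<le> \<bar>e - l\<bar>"
  shows "\<bar>1 / (e - l) - e / (e\<^sup>2 + 1)\<bar> \<le> (1 + \<bar>l\<bar>) / \<kappa> / (e\<^sup>2 + 1)"
proof -
  have e2: "0 < e\<^sup>2 + 1" by (simp add: add_nonneg_pos)
  have pos: "0 < \<kappa> * (1 + \<bar>e\<bar>)" using \<kappa>(1) by simp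
  then have "e - l \<noteq> 0" using \<kappa>(2) by auto
  then have "1 / (e - l) - e / (e\<^sup>2 + 1) = (1 + l * e) / ((e - l) * (e\<^sup>2 + 1))"
    using e2 by (simp add: field_simps power2_eq_square)
  also have "\<bar>\<dots>\<bar> = \<bar>1 + l * e\<bar> / \<bar>e - l\<bar> / (e\<^sup>2 + 1)"
    using e2 by (simp add: abs_mult abs_divide)
  also have "\<dots> \<le> ((1 + \<bar>l\<bar>) * (1 + \<bar>e\<bar>)) / (\<kappa> * (1 + \<bar>e\<bar>)) / (e\<^sup>2 + 1)"
  proof (intro divide_right_mono frac_le)
    have "\<bar>1 + l * e\<bar> \<le> 1 + \<bar>l\<bar> * \<bar>e\<bar>" using abs_triangle_ineq[of 1 "l * e"] by (simp add: abs_mult)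
    also have "\<dots> \<le> (1 + \<bar>l\<bar>) * (1 + \<bar>e\<bar>)" by (simp add: algebra_simps)
    finally show "\<bar>1 + l * e\<bar> \<le> (1 + \<bar>l\<bar>) * (1 + \<bar>e\<bar>)" .
  qed (use \<kappa> pos e2 in auto)
  also have "((1 + \<bar>l\<bar>) * (1 + \<bar>e\<bar>)) / (\<kappa> * (1 + \<bar>e\<bar>)) = (1 + \<bar>l\<bar>) / \<kappa>"
    by simp
  finally show ?thesis .
qed

section \<open>Summation of the resolvent bounds\<close>

context weyl_weights
begin

lemma sum_of_bool_le:
  assumes "finite J" "finite {j. P j}"
  shows "(\<Sum>j\<in>J. w j * of_bool (P j)) \<le> sum w {j. P j}"
proof -
  have "(\<Sum>j\<in>J. w j * of_bool (P j)) = sum w (J \<inter> {j. P j})"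
    unfolding sum.inter_restrict[OF assms(1)] by (intro sum.cong) auto
  also have "\<dots> \<le> sum w {j. P j}" using assms(2) by (intro sum_mono2 w_nonneg) auto
  finally show ?thesis .
qed

text \<open>Sums the pointwise bounds: weight \<open>O(sqrt l)\<close> in the window and below
  \<open>sqrt l\<close>, weight \<open>O(l)\<close> up to \<open>2 * l\<close> with a compensating
  denominator, and a convergent tail. Independence of the finite set \<open>J\<close> lets the
  bounds pass to infinite series.\<close>

lemma remainder_bounds:
  obtains C K where "0 < C" "1 \<le> K"
    "\<And>l g J. \<lbrakk>K \<le> l; 0 < g; g \<le> 1; finite J; \<And>j. j \<in> J \<Longrightarrow> g \<le> \<bar>E j - l\<bar>\<rbrakk> \<Longrightarrow>
      (\<Sum>j\<in>J. w j * \<bar>1 / (E j - l) - E j / ((E j)\<^sup>2 + 1)\<bar>) \<le> C * sqrt l / g \<and>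
      (\<Sum>j\<in>J. w j / (E j - l)\<^sup>2) \<le> C * sqrt l / g\<^sup>2"
proof -
  obtain W X where W: "0 < W" "1 \<le> X" "\<And>x. x \<ge> X \<Longrightarrow> sum w {j. \<bar>E j - x\<bar> < sqrt x} \<le> W * sqrt x"
    using window_bound by blast
  obtain D where D: "1 \<le> D" "\<And>x. x \<ge> 1 \<Longrightarrow> N x \<le> D * x"
    using N_linear by blast
  define S where "S = (\<Sum>j. w j / (E j * sqrt (E j)))"
  have nonneg: "0 \<le> w j / (E j * sqrt (E j))" for j
    using mult_sqrt_nonneg[of "E j"] w_nonneg[of j] by simp
  have S: "(\<Sum>j\<in>J. w j / (E j * sqrt (E j))) \<le> S" if "finite J" for J
    unfolding S_def by (intro sum_le_suminf summable_weights that) (use nonneg in auto)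
  have S0: "0 \<le> S" using S[of "{}"] by simp
  \<comment> \<open>\<open>W\<close> stands for the window, \<open>4 * D\<close> for the energies up
    to \<open>2 * l\<close>, a further \<open>D\<close> for those up to \<open>sqrt l\<close>, and
    \<open>4 * S\<close> for the tail. The sum of squares fits under the same constant.\<close>
  define C where "C = W + 5 * D + 4 * S"
  have "(\<Sum>j\<in>J. w j * \<bar>1 / (E j - l) - E j / ((E j)\<^sup>2 + 1)\<bar>) \<le> C * sqrt l / g \<and>
      (\<Sum>j\<in>J. w j / (E j - l)\<^sup>2) \<le> C * sqrt l / g\<^sup>2"
    if l: "X \<le> l" and g: "0 < g" "g \<le> 1" and J: "finite J" "\<And>j. j \<in> J \<Longrightarrow> g \<le> \<bar>E j - l\<bar>" for l g J
  proof -
    have l1: "1 \<le> l" using l W by simp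
    have sl: "1 \<le> sqrt l" using l1 by simp
    have sl': "l = sqrt l * sqrt l" using l1 by simp
    define x1 where "x1 = (\<Sum>j\<in>J. w j * of_bool (\<bar>E j - l\<bar> < sqrt l))"
    define x2 where "x2 = (\<Sum>j\<in>J. w j * of_bool (E j \<le> 2 * l))"
    define x3 where "x3 = (\<Sum>j\<in>J. w j * of_bool (E j \<le> sqrt l))"
    define x4 where "x4 = (\<Sum>j\<in>J. w j / (E j * sqrt (E j)))"
    have "finite {j. \<bar>E j - l\<bar> < sqrt l}"
      by (rule finite_subset[OF _ finite_below[of "l + sqrt l"]]) auto
    then have x1: "x1 \<le> W * sqrt l" unfolding x1_def using sum_of_bool_le[OF J(1)] W(3)[OF l] by force
    have x2: "x2 \<le> 2 * D * (sqrt l * sqrt l)"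
      unfolding x2_def using sum_of_bool_le[OF J(1) finite_below, of "2 * l"] D(2)[of "2 * l"] l1
      by (simp add: N_def)
    have x3: "x3 \<le> D * sqrt l"
      unfolding x3_def using sum_of_bool_le[OF J(1) finite_below, of "sqrt l"] D(2)[of "sqrt l"] sl
      by (simp add: N_def)
    have x4: "x4 \<le> S" unfolding x4_def by (rule S[OF J(1)])
    have g2: "g\<^sup>2 \<le> 1" using g by (simp add: power_le_one)
    \<comment> \<open>Terms without a gap denominator are enlarged by dividing by \<open>g\<close>
      or \<open>g\<^sup>2\<close>, both at most 1.\<close>
    have mono: "a * sqrt l \<le> a * sqrt l / h" if "0 \<le> a" "0 < h" "h \<le> 1" for a h
      using that sl mult_left_mono[of h 1 "a * sqrt l"] by (simp add: pos_le_divide_eq)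
    have "(\<Sum>j\<in>J. w j * \<bar>1 / (E j - l) - E j / ((E j)\<^sup>2 + 1)\<bar>)
        \<le> (\<Sum>j\<in>J. w j * (of_bool (\<bar>E j - l\<bar> < sqrt l) / g
          + 2 * of_bool (E j \<le> 2 * l) / sqrt l + of_bool (E j \<le> sqrt l) + 4 * sqrt l / (E j * sqrt (E j))))"
      by (intro sum_mono mult_left_mono resolvent_term_bound l1 g J w_nonneg)
    also have "\<dots> = x1 / g + 2 * x2 / sqrt l + x3 + 4 * sqrt l * x4"
      unfolding x1_def x2_def x3_def x4_def
      by (simp add: sum.distrib sum_distrib_left sum_divide_distrib distrib_left mult_ac)
    also have "\<dots> \<le> W * sqrt l / g + 4 * D * sqrt l + D * sqrt l + 4 * S * sqrt l"
    proof (intro add_mono)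
      show "x1 / g \<le> W * sqrt l / g" using x1 g by (intro divide_right_mono) auto
      show "2 * x2 / sqrt l \<le> 4 * D * sqrt l" using x2 sl by (simp add: pos_divide_le_eq)
      show "4 * sqrt l * x4 \<le> 4 * S * sqrt l" using x4 sl by simp
    qed (rule x3)
    also have "\<dots> = W * sqrt l / g + (5 * D + 4 * S) * sqrt l" by (simp add: algebra_simps)
    also have "\<dots> \<le> W * sqrt l / g + (5 * D + 4 * S) * sqrt l / g"
      using mono[of "5 * D + 4 * S" g] g D S0 by simp
    also have "\<dots> = C * sqrt l / g" by (simp add: C_def add_divide_distrib distrib_right)
    finally have 1: "(\<Sum>j\<in>J. w j * \<bar>1 / (E j - l) - E j / ((E j)\<^sup>2 + 1)\<bar>) \<le> C * sqrt l / g" .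
    have "(\<Sum>j\<in>J. w j * (1 / (E j - l)\<^sup>2))
        \<le> (\<Sum>j\<in>J. w j * (of_bool (\<bar>E j - l\<bar> < sqrt l) / g\<^sup>2
          + of_bool (E j \<le> 2 * l) / l + 4 * sqrt l / (E j * sqrt (E j))))"
      by (intro sum_mono mult_left_mono resolvent_square_bound l1 g J w_nonneg)
    also have "\<dots> = x1 / g\<^sup>2 + x2 / l + 4 * sqrt l * x4"
      unfolding x1_def x2_def x3_def x4_def
      by (simp add: sum.distrib sum_distrib_left sum_divide_distrib distrib_left mult_ac)
    also have "\<dots> \<le> W * sqrt l / g\<^sup>2 + 5 * D * sqrt l + 4 * S * sqrt l"
    proof (intro add_mono)
      show "x1 / g\<^sup>2 \<le> W * sqrt l / g\<^sup>2" using x1 g by (intro divide_right_mono) auto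
      have "x2 / l \<le> 2 * D" using x2 l1 by (simp add: pos_divide_le_eq)
      also have "\<dots> \<le> 5 * D * 1" using D by simp
      also have "\<dots> \<le> 5 * D * sqrt l" using sl D by (intro mult_left_mono) auto
      finally show "x2 / l \<le> 5 * D * sqrt l" .
      show "4 * sqrt l * x4 \<le> 4 * S * sqrt l" using x4 sl by simp
    qed
    also have "\<dots> = W * sqrt l / g\<^sup>2 + (5 * D + 4 * S) * sqrt l" by (simp add: algebra_simps)
    also have "\<dots> \<le> W * sqrt l / g\<^sup>2 + (5 * D + 4 * S) * sqrt l / g\<^sup>2"
      using mono[of "5 * D + 4 * S" "g\<^sup>2"] g g2 D S0 by simp
    also have "\<dots> = C * sqrt l / g\<^sup>2" by (simp add: C_def add_divide_distrib distrib_right)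
    finally show ?thesis using 1 by simp
  qed
  then show ?thesis using that[of C X] W D S0 by (simp add: C_def)
qed

lemma summable_inverse_square: "summable (\<lambda>j. w j / ((E j)\<^sup>2 + 1))"
proof (rule summable_comparison_test_ev[OF _ summable_weights])
  have "\<forall>\<^sub>F j in sequentially. 1 \<le> E j" using E_at_top by (simp add: filterlim_at_top)
  then show "\<forall>\<^sub>F j in sequentially. norm (w j / ((E j)\<^sup>2 + 1)) \<le> w j / (E j * sqrt (E j))"
  proof eventually_elim
    case (elim j)
    have "sqrt (E j) \<le> E j" using elim by (intro real_le_lsqrt) (auto simp: power2_eq_square)
    then have "E j * sqrt (E j) \<le> (E j)\<^sup>2 + 1" using elim by (simp add: power2_eq_square add_increasing2)
    then show ?case using w_nonneg[of j] elim by (auto intro!: divide_left_mono mult_pos_pos simp: add_nonneg_pos)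
  qed
qed

text \<open>Only finitely many energies are at most \<open>R\<close>, and for each of them
  \<open>max (a - E j) (E j - b)\<close>, the distance to the interval, is positive. The others are
  so large that the factor 1/4 works for every \<open>l\<close> in it.\<close>

lemma uniform_gap:
  assumes J: "\<And>j. j \<in> J \<Longrightarrow> E j < a \<or> b < E j"
  obtains \<kappa> where "0 < \<kappa>" "\<And>j l. \<lbrakk>j \<in> J; a \<le> l; l \<le> b\<rbrakk> \<Longrightarrow> \<kappa> * (1 + \<bar>E j\<bar>) \<le> \<bar>E j - l\<bar>"
proof -
  define R where "R = 2 * (\<bar>a\<bar> + \<bar>b\<bar>) + 1"
  define F where "F = {j \<in> J. E j \<le> R}"
  have F: "finite F" unfolding F_def by (rule finite_subset[OF _ finite_below[of R]]) auto
  define d where "d j = max (a - E j) (E j - b) / (1 + \<bar>E j\<bar>)" for j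
  have d: "d j > 0" if "j \<in> J" for j unfolding d_def using J[OF that] by (intro divide_pos_pos) auto
  define \<kappa> where "\<kappa> = Min (insert (1/4) (d ` F))"
  have "\<kappa> > 0" unfolding \<kappa>_def using F d by (auto simp: F_def)
  moreover have "\<kappa> * (1 + \<bar>E j\<bar>) \<le> \<bar>E j - l\<bar>" if j: "j \<in> J" and l: "a \<le> l" "l \<le> b" for j l
  proof (cases "E j \<le> R")
    case True
    have "\<kappa> \<le> d j" unfolding \<kappa>_def using F True j by (intro Min_le) (auto simp: F_def)
    then have "\<kappa> * (1 + \<bar>E j\<bar>) \<le> max (a - E j) (E j - b)" unfolding d_def by (simp add: pos_le_divide_eq)
    also have "\<dots> \<le> \<bar>E j - l\<bar>" using l by auto
    finally show ?thesis .
  next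
    case False
    have "\<kappa> \<le> 1/4" unfolding \<kappa>_def using F by (intro Min_le) auto
    then have "\<kappa> * (1 + \<bar>E j\<bar>) \<le> 1/4 * (1 + \<bar>E j\<bar>)" by (intro mult_right_mono) auto
    also have "\<dots> \<le> \<bar>E j - l\<bar>" using False l unfolding R_def by auto
    finally show ?thesis .
  qed
  ultimately show ?thesis by (rule that)
qed

end

section \<open>Eigenfunctions of the perturbed operator\<close>

lemma has_value_diff_scale:
  assumes f: "has_value \<mu> M p f z" and g: "continuous (at p within M) g"
  shows "has_value \<mu> M p (\<lambda>x. f x - t * g x) (z - t * g p)"
proof -
  obtain f' where f': "AE x in \<mu>. f x = f' x" "continuous (at p within M) f'" "f' p = z"
    using f unfolding has_value_def by blast
  show ?thesis
    unfolding has_value_def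
  proof (intro exI[of _ "\<lambda>x. f' x - t * g x"] conjI)
    show "AE x in \<mu>. f x - t * g x = f' x - t * g x" using f'(1) by eventually_elim simp
    show "continuous (at p within M) (\<lambda>x. f' x - t * g x)" using f'(2) g by (intro continuous_intros)
  qed (use f' in simp)
qed

text \<open>Applied with \<open>T\<close> equal to \<open>\<Delta>\<close>: the Laplacian is given
  as a mere set of pairs, and its linearity comes from being its own adjoint.\<close>

lemma adjoint_op_diff_scale:
  assumes "(f, k) \<in> adjoint_op \<mu> T" "(g, h) \<in> adjoint_op \<mu> T"
    and T: "Domain T \<subseteq> L2 \<mu>" "Range T \<subseteq> L2 \<mu>"
  shows "((\<lambda>x. f x - t * g x), (\<lambda>x. k x - t * h x)) \<in> adjoint_op \<mu> T"
proof -
  have L2: "f \<in> L2 \<mu>" "k \<in> L2 \<mu>" "g \<in> L2 \<mu>" "h \<in> L2 \<mu>"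
    using assms(1,2) by (auto simp: adjoint_op_def)
  have "l2inner \<mu> v (\<lambda>x. f x - t * g x) = l2inner \<mu> u (\<lambda>x. k x - t * h x)" if "(u, v) \<in> T" for u v
  proof -
    have "u \<in> L2 \<mu>" "v \<in> L2 \<mu>" using that T by auto
    moreover have "l2inner \<mu> v f = l2inner \<mu> u k" "l2inner \<mu> v g = l2inner \<mu> u h"
      using that assms(1,2) by (auto simp: adjoint_op_def)
    ultimately show ?thesis
      by (simp add: l2inner_diff_right l2inner_scale_right L2_scale L2)
  qed
  then show ?thesis by (auto simp: adjoint_op_def intro!: L2_diff L2_scale L2)
qed

section \<open>The Laplacian on expansions and values at the point \<open>p\<close>\<close>

context point_scatterer
begin

lemma Phi_in: "\<Phi> j \<in> B" "\<Phi> j p \<noteq> 0"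
  using Phi_enum by (auto simp: bij_betw_def)

sublocale orthonormal_seq \<mu> \<Phi>
proof
  show "\<Phi> j \<in> L2 \<mu>" for j using basis Phi_in by (auto simp: orthonormal_basis_def)
  have "inj \<Phi>" using Phi_enum by (simp add: bij_betw_def)
  then show "l2inner \<mu> (\<Phi> i) (\<Phi> j) = (if i = j then 1 else 0)" for i j
    using basis Phi_in by (auto simp: orthonormal_basis_def inj_eq)
qed

abbreviation w :: "nat \<Rightarrow> real" where "w j \<equiv> (cmod (\<Phi> j p))\<^sup>2"

sublocale weyl_weights w E
  by unfold_locales (use Phi_in E_mono weyl in auto)

lemma Delta_adjoint: "\<Delta> = adjoint_op \<mu> \<Delta>"
  using laplacian unfolding self_adjoint_laplacian_def self_adjoint_def by blast

lemma Delta_L2: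
  assumes "(f, h) \<in> \<Delta>"
  shows "f \<in> L2 \<mu>" "h \<in> L2 \<mu>"
proof -
  have "(f, h) \<in> adjoint_op \<mu> \<Delta>" using assms by (simp flip: Delta_adjoint)
  then show "f \<in> L2 \<mu>" "h \<in> L2 \<mu>" by (auto simp: adjoint_op_def)
qed

lemma Delta_symmetric:
  assumes "(f, h) \<in> \<Delta>" "(g, k) \<in> \<Delta>"
  shows "l2inner \<mu> h g = l2inner \<mu> f k"
proof -
  have "(g, k) \<in> adjoint_op \<mu> \<Delta>" using assms(2) by (simp flip: Delta_adjoint)
  then show ?thesis using assms(1) by (auto simp: adjoint_op_def)
qed

lemma Delta_diff_scale:
  assumes "(f, h) \<in> \<Delta>" "(g, k) \<in> \<Delta>"
  shows "((\<lambda>x. f x - t * g x), (\<lambda>x. h x - t * k x)) \<in> \<Delta>"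
  using adjoint_op_diff_scale[of f h \<mu> \<Delta> g k t, folded Delta_adjoint] assms Delta_L2 by blast

lemma Delta_Phi_coeff:
  assumes "(f, h) \<in> \<Delta>"
  shows "l2inner \<mu> h (\<Phi> j) = - of_real (E j) * l2inner \<mu> f (\<Phi> j)"
  using Delta_symmetric[OF assms Phi_eigen[of j]] l2inner_scale_right[of \<mu> f "- of_real (E j)" "\<Phi> j"]
  by simp

text \<open>A pair belongs to a self-adjoint graph once it passes the symmetry test against that
  graph. Here both sides of the test are the same series, because the \<open>E j\<close> are
  real.\<close>

lemma Delta_expands:
  assumes f: "expands c f" and h: "expands (\<lambda>j. - of_real (E j) * c j) h"
  shows "(f, h) \<in> \<Delta>"
proof -
  have "l2inner \<mu> k f = l2inner \<mu> u h" if "(u, k) \<in> \<Delta>" for u k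
  proof -
    have "cnj (c j) * l2inner \<mu> k (\<Phi> j) = cnj (- of_real (E j) * c j) * l2inner \<mu> u (\<Phi> j)" for j
      by (simp add: Delta_Phi_coeff[OF that])
    then show ?thesis
      using expands_l2inner[OF f Delta_L2(2)[OF that]] expands_l2inner[OF h Delta_L2(1)[OF that]]
      by (simp add: sums_unique2)
  qed
  then have "(f, h) \<in> adjoint_op \<mu> \<Delta>"
    using l2_sums_L2[OF f] l2_sums_L2[OF h] by (auto simp: adjoint_op_def)
  then show ?thesis by (simp flip: Delta_adjoint)
qed

text \<open>Coefficients of the Green function with pole at \<open>p\<close>. The values
  \<open>\<i>\<close> and \<open>- \<i>\<close> of \<open>z\<close> give the deficiency vectors,
  real \<open>z\<close> the eigenfunctions and, cut down to two indices, the quasimodes.\<close>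

definition green_coeff :: "complex \<Rightarrow> nat \<Rightarrow> complex" where
  "green_coeff z j = cnj (\<Phi> j p) / (of_real (E j) - z)"

lemma summable_coeff:
  assumes "\<And>j. (cmod (r j))\<^sup>2 \<le> C / ((E j)\<^sup>2 + 1)"
  shows "summable (\<lambda>j. (cmod (cnj (\<Phi> j p) * r j))\<^sup>2)"
proof (rule summable_comparison_test'[OF summable_mult[OF summable_inverse_square, of C]])
  fix j
  have "w j * (cmod (r j))\<^sup>2 \<le> w j * (C / ((E j)\<^sup>2 + 1))" by (intro mult_left_mono assms) simp
  then show "norm ((cmod (cnj (\<Phi> j p) * r j))\<^sup>2) \<le> C * (w j / ((E j)\<^sup>2 + 1))"
    by (simp add: norm_mult power_mult_distrib mult_ac)
qed

text \<open>\<open>g_vec\<close> is picked by \<open>SOME\<close>, so nothing is known about it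
  until its series is shown to converge in \<open>L2\<close>.\<close>

lemma g_vec_expands:
  assumes "z \<in> {\<i>, - \<i>}"
  shows "expands (green_coeff z) (g_vec \<mu> \<Phi> E p z)"
proof -
  have "(cmod (1 / (of_real (E j) - z)))\<^sup>2 \<le> 1 / ((E j)\<^sup>2 + 1)" for j
    using assms by (auto simp: norm_divide power_divide cmod_power2)
  then have "summable (\<lambda>j. (cmod (cnj (\<Phi> j p) * (1 / (of_real (E j) - z))))\<^sup>2)"
    by (rule summable_coeff)
  then obtain g where "expands (\<lambda>j. cnj (\<Phi> j p) * (1 / (of_real (E j) - z))) g"
    by (rule expands_exists)
  then have "l2_sums \<mu> (\<lambda>j x. cnj (\<Phi> j p) / (of_real (E j) - z) * \<Phi> j x) g" by simp
  then have "\<exists>g. l2_sums \<mu> (\<lambda>j x. cnj (\<Phi> j p) / (of_real (E j) - z) * \<Phi> j x) g" by blast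
  then show ?thesis
    unfolding g_vec_def l2_suminf_def green_coeff_def by (rule someI_ex)
qed

text \<open>After subtraction of a multiple of \<open>\<Phi>\<^sub>0\<close> an element of \<open>Dom \<Delta>\<close> lies in \<open>D\<^sub>p\<close>, and
  there the equation \<open>H\<^sub>0\<^sup>* g\<^sub>i = i g\<^sub>i\<close> says that the expansion sums to \<open>0\<close> at \<open>p\<close>.\<close>

lemma value_eq_expansion:
  assumes f: "(f, h) \<in> \<Delta>" and z: "has_value \<mu> M p f z"
  shows "(\<lambda>j. l2inner \<mu> f (\<Phi> j) * \<Phi> j p) sums z"
proof -
  define t where "t = z / \<Phi> 0 p"
  define f' where "f' = (\<lambda>x. f x - t * \<Phi> 0 x)"
  define h' where "h' = (\<lambda>x. h x - t * (- of_real (E 0) * \<Phi> 0 x))"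
  have f': "(f', h') \<in> \<Delta>" unfolding f'_def h'_def by (rule Delta_diff_scale[OF f Phi_eigen])
  have "has_value \<mu> M p f' (z - t * \<Phi> 0 p)"
    unfolding f'_def by (rule has_value_diff_scale[OF z basis_cont[OF Phi_in(1)]])
  then have "f' \<in> D_p \<mu> M \<Delta> p" using f' Phi_in(2)[of 0] by (auto simp: D_p_def t_def)
  then have H0: "(f', \<lambda>x. - h' x) \<in> H_0 \<mu> M \<Delta> p" using f' by (auto simp: H_0_def)
  let ?g = "g_vec \<mu> \<Phi> E p \<i>"
  have g: "expands (green_coeff \<i>) ?g" by (rule g_vec_expands) simp
  \<comment> \<open>\<open>deficiency\<close> is an equality of sets; the multiple
    \<open>c = 1\<close> places the vector itself in the kernel.\<close>
  have "?g \<in> {f \<in> L2 \<mu>. \<exists>c. AE x in \<mu>. f x = c * ?g x}"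
    using l2_sums_L2[OF g] by (auto intro!: exI[of _ 1])
  then have "(?g, \<lambda>x. \<i> * ?g x) \<in> adjoint_op \<mu> (H_0 \<mu> M \<Delta> p)"
    using deficiency[of \<i>] by blast
  then have "l2inner \<mu> (\<lambda>x. - h' x) ?g = l2inner \<mu> f' (\<lambda>x. \<i> * ?g x)"
    using H0 by (auto simp: adjoint_op_def)
  then have eq: "l2inner \<mu> h' ?g = \<i> * l2inner \<mu> f' ?g"
    using l2inner_scale_left[of \<mu> "-1" h' ?g] by (simp add: l2inner_scale_right)
  \<comment> \<open>The coefficients of \<open>h'\<close> are those of \<open>f'\<close> times
    \<open>- E j\<close>, so each term contains \<open>E j + \<i>\<close>, which cancels the
    denominator of the conjugated coefficient.\<close>
  have "(\<lambda>j. \<i> * (cnj (green_coeff \<i> j) * l2inner \<mu> f' (\<Phi> j)) - cnj (green_coeff \<i> j) * l2inner \<mu> h' (\<Phi> j))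
      sums (\<i> * l2inner \<mu> f' ?g - l2inner \<mu> h' ?g)"
    by (intro sums_diff sums_mult expands_l2inner g Delta_L2[OF f'])
  moreover have "\<i> * (cnj (green_coeff \<i> j) * l2inner \<mu> f' (\<Phi> j)) - cnj (green_coeff \<i> j) * l2inner \<mu> h' (\<Phi> j)
      = l2inner \<mu> f' (\<Phi> j) * \<Phi> j p" for j
  proof -
    have "of_real (E j) + \<i> \<noteq> 0" by (simp add: complex_eq_iff)
    then have "\<Phi> j p = cnj (green_coeff \<i> j) * (of_real (E j) + \<i>)"
      by (simp add: green_coeff_def)
    then show ?thesis
      by (simp add: Delta_Phi_coeff[OF f'] algebra_simps)
  qed
  ultimately have S: "(\<lambda>j. l2inner \<mu> f' (\<Phi> j) * \<Phi> j p) sums 0" using eq by simp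
  have coeff: "l2inner \<mu> f (\<Phi> j) * \<Phi> j p
      = l2inner \<mu> f' (\<Phi> j) * \<Phi> j p + (if j = 0 then t * \<Phi> j p else 0)" for j
    unfolding f'_def
    by (simp add: l2inner_diff_left Delta_L2[OF f] L2_scale Phi_L2 l2inner_scale_left ortho algebra_simps)
  have "(\<lambda>j. l2inner \<mu> f (\<Phi> j) * \<Phi> j p) sums (0 + t * \<Phi> 0 p)"
    unfolding coeff by (rule sums_add[OF S sums_single])
  then show ?thesis using Phi_in(2)[of 0] by (simp add: t_def)
qed

text \<open>The subtracted fraction is the real part of \<open>1 / (E j - \<i>)\<close>. It comes
  from the mean of the two deficiency vectors and makes the weighted series converge.\<close>

definition spectral_term :: "real \<Rightarrow> nat \<Rightarrow> real" where
  "spectral_term l j = 1 / (E j - l) - E j / ((E j)\<^sup>2 + 1)"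

lemma green_coeff_expands:
  assumes \<kappa>: "0 < \<kappa>" "\<And>j. \<kappa> * (1 + \<bar>E j\<bar>) \<le> \<bar>E j - l\<bar>"
  obtains g where "expands (green_coeff (of_real l)) g"
proof -
  have "(cmod (1 / of_real (E j - l)))\<^sup>2 \<le> (1 / \<kappa>\<^sup>2) / ((E j)\<^sup>2 + 1)" for j
  proof -
    have "\<kappa>\<^sup>2 * ((E j)\<^sup>2 + 1) \<le> \<kappa>\<^sup>2 * (1 + \<bar>E j\<bar>)\<^sup>2"
      by (intro mult_left_mono) (auto simp: power2_sum)
    also have "\<dots> \<le> \<bar>E j - l\<bar>\<^sup>2"
      using power_mono[OF \<kappa>(2)[of j], of 2] \<kappa>(1) by (simp add: power_mult_distrib)
    finally have "1 / (E j - l)\<^sup>2 \<le> 1 / (\<kappa>\<^sup>2 * ((E j)\<^sup>2 + 1))"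
      using \<kappa>(1) by (intro frac_le) (auto simp: add_nonneg_pos)
    then show ?thesis by (simp add: norm_divide power_divide norm_of_real del: of_real_diff)
  qed
  then have "summable (\<lambda>j. (cmod (cnj (\<Phi> j p) * (1 / of_real (E j - l))))\<^sup>2)"
    by (rule summable_coeff)
  then obtain g where "expands (\<lambda>j. cnj (\<Phi> j p) * (1 / of_real (E j - l))) g"
    by (rule expands_exists)
  then show ?thesis by (intro that) (simp add: green_coeff_def [abs_def])
qed

text \<open>Two things are checked. The regular component \<open>f\<close> lies in the domain of
  \<open>\<Delta>\<close>, because its coefficients stay square-summable after multiplication by
  \<open>E j\<close>, and \<open>spectral\<close> makes its value at \<open>p\<close> zero. The
  adjoint equation is tested on \<open>D_p\<close>. The factor \<open>r\<close> carries the
  normalisation along, so that linearity of \<open>H_op\<close> need not be proved.\<close>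

lemma eigenfunction:
  assumes \<kappa>: "0 < \<kappa>" "\<And>j. \<kappa> * (1 + \<bar>E j\<bar>) \<le> \<bar>E j - l\<bar>"
    and spectral: "(\<lambda>j. w j * spectral_term l j) sums 0"
    and \<gamma>: "expands (green_coeff (of_real l)) \<gamma>"
  shows "((\<lambda>x. r * \<gamma> x), (\<lambda>x. of_real l * (r * \<gamma> x))) \<in> H_op \<mu> M \<Delta> p \<Phi> E pi"
proof -
  let ?g1 = "g_vec \<mu> \<Phi> E p \<i>" and ?g2 = "g_vec \<mu> \<Phi> E p (- \<i>)"
  define f where "f = (\<lambda>x. \<gamma> x - (1/2) * (?g1 x + ?g2 x))"
  define c where "c j = cnj (\<Phi> j p) * of_real (spectral_term l j)" for j
  have ne: "E j \<noteq> l" for j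
  proof -
    have "0 < \<kappa> * (1 + \<bar>E j\<bar>)" using \<kappa>(1) by simp
    then show ?thesis using \<kappa>(2)[of j] by auto
  qed
  have "green_coeff (of_real l) j - (1/2) * (green_coeff \<i> j + green_coeff (- \<i>) j) = c j" for j
  proof -
    have 1: "complex_of_real (E j) - \<i> \<noteq> 0" "complex_of_real (E j) + \<i> \<noteq> 0"
      by (auto simp: complex_eq_iff)
    have 2: "(complex_of_real (E j) - \<i>) * (of_real (E j) + \<i>) = of_real ((E j)\<^sup>2 + 1)"
      by (simp add: algebra_simps power2_eq_square)
    have "1 / (complex_of_real (E j) - \<i>) + 1 / (of_real (E j) + \<i>) = 2 * of_real (E j) / of_real ((E j)\<^sup>2 + 1)"
      unfolding add_frac_eq[OF 1] 2 by simp
    moreover have "green_coeff \<i> j + green_coeff (- \<i>) j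
        = cnj (\<Phi> j p) * (1 / (complex_of_real (E j) - \<i>) + 1 / (of_real (E j) + \<i>))"
      by (simp add: green_coeff_def distrib_left)
    ultimately show ?thesis
      by (simp add: c_def green_coeff_def spectral_term_def algebra_simps)
  qed
  moreover have "expands (\<lambda>j. green_coeff (of_real l) j - (1/2) * (green_coeff \<i> j + green_coeff (- \<i>) j)) f"
    unfolding f_def by (intro expands_diff expands_scale expands_add \<gamma> g_vec_expands) auto
  ultimately have f: "expands c f" by simp
  have "(cmod (of_real (- E j * spectral_term l j)))\<^sup>2 \<le> ((1 + \<bar>l\<bar>) / \<kappa>)\<^sup>2 / ((E j)\<^sup>2 + 1)" for j
  proof -
    have e2: "0 < (E j)\<^sup>2 + 1" by (simp add: add_nonneg_pos)
    have "(cmod (of_real (- E j * spectral_term l j)))\<^sup>2 = (E j)\<^sup>2 * \<bar>spectral_term l j\<bar>\<^sup>2"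
      by (simp add: norm_mult power_mult_distrib)
    also have "\<dots> \<le> ((E j)\<^sup>2 + 1) * ((1 + \<bar>l\<bar>) / \<kappa> / ((E j)\<^sup>2 + 1))\<^sup>2"
      using resolvent_term_majorant[OF \<kappa>] unfolding spectral_term_def
      by (intro mult_mono power_mono) auto
    also have "\<dots> = ((1 + \<bar>l\<bar>) / \<kappa>)\<^sup>2 / ((E j)\<^sup>2 + 1)"
    proof -
      have "d * (x / d)\<^sup>2 = x\<^sup>2 / d" if "0 < d" for d x :: real
        using that by (simp add: power2_eq_square)
      from this[OF e2] show ?thesis .
    qed
    finally show ?thesis .
  qed
  then have "summable (\<lambda>j. (cmod (cnj (\<Phi> j p) * of_real (- E j * spectral_term l j)))\<^sup>2)"
    by (rule summable_coeff)
  then obtain h where "expands (\<lambda>j. cnj (\<Phi> j p) * of_real (- E j * spectral_term l j)) h"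
    by (rule expands_exists)
  then have h: "expands (\<lambda>j. - of_real (E j) * c j) h" by (simp add: c_def mult_ac)
  have fh: "(f, h) \<in> \<Delta>" by (rule Delta_expands[OF f h])
  then obtain z where z: "has_value \<mu> M p f z" using point_values by blast
  have "l2inner \<mu> f (\<Phi> j) * \<Phi> j p = of_real (w j * spectral_term l j)" for j
    unfolding expands_coeff[OF f] c_def of_real_mult complex_norm_square by (simp only: mult_ac)
  then have "(\<lambda>j. complex_of_real (w j * spectral_term l j)) sums z"
    using value_eq_expansion[OF fh z] by simp
  then have "z = 0" using spectral sums_of_real[OF spectral, where 'a = complex] sums_unique2 by fastforce
  then have fD: "(f, h) \<in> \<Delta>" "f \<in> D_p \<mu> M \<Delta> p" using fh z by (auto simp: D_p_def)
  have rfD: "(\<lambda>x. r * f x) \<in> D_p \<mu> M \<Delta> p"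
  proof -
    obtain f' where "AE x in \<mu>. f x = f' x" "continuous (at p within M) f'" "f' p = 0"
      using fD(2) unfolding D_p_def has_value_def by blast
    then have "has_value \<mu> M p (\<lambda>x. r * f x) 0"
      unfolding has_value_def by (intro exI[of _ "\<lambda>x. r * f' x"]) (auto intro!: continuous_intros)
    \<comment> \<open>Scaling is obtained from the difference rule, as
      \<open>f - (1 - r) * f\<close>.\<close>
    moreover have "((\<lambda>x. r * f x), (\<lambda>x. r * h x)) \<in> \<Delta>"
      using Delta_diff_scale[OF fh fh, of "1 - r"] by (simp add: algebra_simps)
    ultimately show ?thesis by (auto simp: D_p_def)
  qed
  have gL2: "\<gamma> \<in> L2 \<mu>" by (rule l2_sums_L2[OF \<gamma>])
  have "l2inner \<mu> (\<lambda>x. - k x) (\<lambda>x. r * \<gamma> x) = l2inner \<mu> u (\<lambda>x. of_real l * (r * \<gamma> x))"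
    if uk: "(u, k) \<in> \<Delta>" and u: "u \<in> D_p \<mu> M \<Delta> p" for u k
  proof -
    \<comment> \<open>Each term of this combination contains \<open>E j - l\<close>, which cancels
      the denominator; what remains is the series for the value of \<open>u\<close> at
      \<open>p\<close>, which is 0.\<close>
    have "(\<lambda>j. - of_real l * (cnj (green_coeff (of_real l) j) * l2inner \<mu> u (\<Phi> j))
        - cnj (green_coeff (of_real l) j) * l2inner \<mu> k (\<Phi> j))
      sums (- of_real l * l2inner \<mu> u \<gamma> - l2inner \<mu> k \<gamma>)"
      by (intro sums_diff sums_mult expands_l2inner \<gamma> Delta_L2[OF uk])
    moreover have "- of_real l * (cnj (green_coeff (of_real l) j) * l2inner \<mu> u (\<Phi> j))
        - cnj (green_coeff (of_real l) j) * l2inner \<mu> k (\<Phi> j) = l2inner \<mu> u (\<Phi> j) * \<Phi> j p" for j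
    proof -
      have phi: "\<Phi> j p = cnj (green_coeff (of_real l) j) * (of_real (E j) - of_real l)"
        using ne[of j] by (simp add: green_coeff_def)
      show ?thesis
        unfolding phi Delta_Phi_coeff[OF uk] by (simp add: algebra_simps)
    qed
    ultimately have "(\<lambda>j. l2inner \<mu> u (\<Phi> j) * \<Phi> j p) sums (- of_real l * l2inner \<mu> u \<gamma> - l2inner \<mu> k \<gamma>)"
      by simp
    moreover have "has_value \<mu> M p u 0" using u by (simp add: D_p_def)
    ultimately have "- of_real l * l2inner \<mu> u \<gamma> - l2inner \<mu> k \<gamma> = 0"
      using value_eq_expansion[OF uk] sums_unique2 by blast
    then have "- l2inner \<mu> k \<gamma> = of_real l * l2inner \<mu> u \<gamma>" by (metis add.inverse_inverse minus_mult_left right_minus_eq)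
    then show ?thesis
      using l2inner_scale_left[of \<mu> "-1" k] by (simp add: l2inner_scale_right algebra_simps)
  qed
  then have "((\<lambda>x. r * \<gamma> x), (\<lambda>x. of_real l * (r * \<gamma> x))) \<in> adjoint_op \<mu> (H_0 \<mu> M \<Delta> p)"
    by (auto simp: adjoint_op_def H_0_def intro!: L2_scale gL2)
  moreover have "AE x in \<mu>. r * \<gamma> x = r * f x + r / 2 * ?g1 x + r / 2 * ?g2 x"
    by (simp add: f_def algebra_simps)
  \<comment> \<open>Since \<open>cis pi\<close> is -1, equal coefficients of the two deficiency
    vectors are the boundary condition for the parameter \<open>pi\<close>.\<close>
  moreover have "r / 2 = - cis pi * (r / 2)" by (simp add: cis_pi)
  ultimately show ?thesis
    unfolding H_op_def mem_Collect_eq case_prod_conv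
    by (intro conjI bexI[OF _ rfD] exI[of _ "r / 2"])
qed

end

section \<open>Zeros of the spectral function between consecutive eigenvalues\<close>

text \<open>The difference is \<open>(1 / F - 1 / N) * f + (f - g) / N\<close>, and by the reverse
  triangle inequality each piece has norm at most \<open>D / N\<close>.\<close>

lemma l2norm_normalise_diff:
  assumes f: "f \<in> L2 \<mu>" "0 < l2norm \<mu> f" and g: "g \<in> L2 \<mu>" "0 < l2norm \<mu> g"
  shows "l2norm \<mu> (\<lambda>x. of_real (1 / l2norm \<mu> f) * f x - g x / of_real (l2norm \<mu> g))
    \<le> 2 * l2norm \<mu> (\<lambda>x. f x - g x) / l2norm \<mu> g"
proof -
  define F N D where "F = l2norm \<mu> f" and "N = l2norm \<mu> g" and "D = l2norm \<mu> (\<lambda>x. f x - g x)"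
  have pos: "0 < F" "0 < N" using f g by (auto simp: F_def N_def)
  have "F \<le> D + N" "N \<le> D + F"
    using l2norm_triangle[OF L2_diff[OF f(1) g(1)] g(1)] l2norm_triangle[OF L2_diff[OF g(1) f(1)] f(1)]
    by (auto simp: F_def N_def D_def l2norm_diff_commute[of \<mu> g f])
  then have FN: "\<bar>N - F\<bar> \<le> D" by linarith
  have "(\<lambda>x. of_real (1 / F) * f x - g x / of_real N)
      = (\<lambda>x. of_real (1 / F - 1 / N) * f x + of_real (1 / N) * (f x - g x))"
    using pos by (auto simp: field_simps)
  then have eq: "l2norm \<mu> (\<lambda>x. of_real (1 / F) * f x - g x / of_real N)
      = l2norm \<mu> (\<lambda>x. of_real (1 / F - 1 / N) * f x + of_real (1 / N) * (f x - g x))"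
    by (rule arg_cong)
  have "l2norm \<mu> (\<lambda>x. of_real (1 / F) * f x - g x / of_real N)
      \<le> l2norm \<mu> (\<lambda>x. of_real (1 / F - 1 / N) * f x) + l2norm \<mu> (\<lambda>x. of_real (1 / N) * (f x - g x))"
    unfolding eq by (rule l2norm_triangle[OF L2_scale[OF f(1)] L2_scale[OF L2_diff[OF f(1) g(1)]]])
  also have "\<dots> = \<bar>1 / F - 1 / N\<bar> * F + D / N"
    using pos by (simp only: l2norm_scale norm_of_real F_def[symmetric] D_def[symmetric]) simp
  also have "\<bar>1 / F - 1 / N\<bar> * F = \<bar>N - F\<bar> / N"
  proof -
    have "1 / F - 1 / N = (N - F) / (F * N)" using pos by (simp add: field_simps)
    then show ?thesis using pos by (simp add: abs_mult abs_divide)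
  qed
  also have "\<bar>N - F\<bar> / N + D / N \<le> 2 * D / N"
    using FN pos by (simp flip: add_divide_distrib add: divide_right_mono)
  finally show ?thesis by (simp add: F_def N_def D_def)
qed

text \<open>The displacement of the zero is \<open>l - m = - R (l - E\<^sub>b) (E\<^sub>c - l) / (w\<^sub>b + w\<^sub>c)\<close>.\<close>

lemma pole_perturbation:
  fixes wb wc eb ec l m R :: real
  assumes w: "0 < wb" "0 < wc" and l: "eb < l" "l < ec" and m: "eb < m" "m < ec"
    and zero_l: "wc * (l - eb) - wb * (ec - l) + R * ((l - eb) * (ec - l)) = 0"
    and zero_m: "wc * (m - eb) = wb * (ec - m)"
  shows "\<bar>1 / (eb - l) - 1 / (eb - m)\<bar> \<le> \<bar>R\<bar> * (ec - eb) / (wb + wc) * \<bar>1 / (eb - m)\<bar>"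
    and "\<bar>1 / (ec - l) - 1 / (ec - m)\<bar> \<le> \<bar>R\<bar> * (ec - eb) / (wb + wc) * \<bar>1 / (ec - m)\<bar>"
proof -
  have s: "0 < wb + wc" using w by simp
  have "(wb + wc) * (l - m) = - R * ((l - eb) * (ec - l))"
    using zero_l zero_m by (simp add: algebra_simps)
  then have lm: "l - m = - R * ((l - eb) * (ec - l)) / (wb + wc)"
    using s by (simp add: field_simps)
  have abs_lm: "\<bar>l - m\<bar> = \<bar>R\<bar> * ((l - eb) * (ec - l)) / (wb + wc)"
    unfolding lm using s l by (simp add: abs_mult)
  have cancel: "a * (x * y) / s / x = a * y / s" "a * (x * y) / s / y = a * x / s"
    if "0 < x" "0 < y" for a x y s :: real
    using that by simp_all
  have "\<bar>1 / (eb - l) - 1 / (eb - m)\<bar> = \<bar>l - m\<bar> / (l - eb) * \<bar>1 / (eb - m)\<bar>"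
  proof -
    have "1 / (eb - l) - 1 / (eb - m) = (l - m) / (eb - l) * (1 / (eb - m))"
      using l m by (simp add: field_simps)
    then show ?thesis using l by (simp add: abs_mult abs_divide)
  qed
  also have "\<bar>l - m\<bar> / (l - eb) = \<bar>R\<bar> * (ec - l) / (wb + wc)"
    unfolding abs_lm using l by (intro cancel) auto
  also have "\<dots> * \<bar>1 / (eb - m)\<bar> \<le> \<bar>R\<bar> * (ec - eb) / (wb + wc) * \<bar>1 / (eb - m)\<bar>"
    using l s by (intro mult_right_mono divide_right_mono mult_left_mono) auto
  finally show "\<bar>1 / (eb - l) - 1 / (eb - m)\<bar> \<le> \<bar>R\<bar> * (ec - eb) / (wb + wc) * \<bar>1 / (eb - m)\<bar>" .
  have "\<bar>1 / (ec - l) - 1 / (ec - m)\<bar> = \<bar>l - m\<bar> / (ec - l) * \<bar>1 / (ec - m)\<bar>"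
  proof -
    have "1 / (ec - l) - 1 / (ec - m) = (l - m) / (ec - l) * (1 / (ec - m))"
      using l m by (simp add: field_simps)
    then show ?thesis using l by (simp add: abs_mult abs_divide)
  qed
  also have "\<bar>l - m\<bar> / (ec - l) = \<bar>R\<bar> * (l - eb) / (wb + wc)"
    unfolding abs_lm using l by (intro cancel) auto
  also have "\<dots> * \<bar>1 / (ec - m)\<bar> \<le> \<bar>R\<bar> * (ec - eb) / (wb + wc) * \<bar>1 / (ec - m)\<bar>"
    using l s by (intro mult_right_mono divide_right_mono mult_left_mono) auto
  finally show "\<bar>1 / (ec - l) - 1 / (ec - m)\<bar> \<le> \<bar>R\<bar> * (ec - eb) / (wb + wc) * \<bar>1 / (ec - m)\<bar>" .
qed

section \<open>The spectral function with its two nearest poles removed\<close>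

context point_scatterer
begin

lemma w_positive: "0 < w j"
  using Phi_in(2) by simp

definition regular_term :: "nat \<Rightarrow> real \<Rightarrow> nat \<Rightarrow> real" where
  "regular_term b l j = (if j = b \<or> j = Suc b then 0 else w j * spectral_term l j)"

text \<open>Only the polar fractions at \<open>b\<close> and \<open>Suc b\<close> are taken out of
  the spectral sum. Their regularising fractions stay, as the subtracted constant.\<close>

definition regular_part :: "nat \<Rightarrow> real \<Rightarrow> real" where
  "regular_part b l = (\<Sum>j. regular_term b l j)
     - (w b * (E b / ((E b)\<^sup>2 + 1)) + w (Suc b) * (E (Suc b) / ((E (Suc b))\<^sup>2 + 1)))"

lemma outside_gap:
  assumes "j \<noteq> b" "j \<noteq> Suc b"
  shows "E j < E b \<or> E (Suc b) < E j"
  using assms E_mono by (cases "j < b") (auto simp: strict_mono_less)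

text \<open>One \<open>C\<close> serves the whole closed interval, end points included, as the
  Weierstrass test requires.\<close>

lemma regular_term_majorant:
  obtains C where "\<And>j l. \<lbrakk>E b \<le> l; l \<le> E (Suc b)\<rbrakk> \<Longrightarrow>
    norm (regular_term b l j) \<le> C * (w j / ((E j)\<^sup>2 + 1))"
proof -
  obtain \<kappa> where \<kappa>: "0 < \<kappa>"
    "\<And>j l. \<lbrakk>j \<in> - {b, Suc b}; E b \<le> l; l \<le> E (Suc b)\<rbrakk> \<Longrightarrow> \<kappa> * (1 + \<bar>E j\<bar>) \<le> \<bar>E j - l\<bar>"
    using uniform_gap[of "- {b, Suc b}" "E b" "E (Suc b)"] outside_gap by auto
  define C where "C = (1 + (\<bar>E b\<bar> + \<bar>E (Suc b)\<bar>)) / \<kappa>"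
  have C: "0 \<le> C" using \<kappa>(1) by (simp add: C_def)
  have "norm (regular_term b l j) \<le> C * (w j / ((E j)\<^sup>2 + 1))" if l: "E b \<le> l" "l \<le> E (Suc b)" for j l
  proof (cases "j = b \<or> j = Suc b")
    case True
    then show ?thesis using C by (simp add: regular_term_def add_nonneg_nonneg)
  next
    case False
    then have "\<bar>spectral_term l j\<bar> \<le> (1 + \<bar>l\<bar>) / \<kappa> / ((E j)\<^sup>2 + 1)"
      unfolding spectral_term_def using \<kappa>(2)[OF _ l] by (intro resolvent_term_majorant \<kappa>(1)) auto
    also have "\<dots> \<le> C / ((E j)\<^sup>2 + 1)"
      unfolding C_def using l \<kappa>(1) by (intro divide_right_mono) auto
    finally have "w j * \<bar>spectral_term l j\<bar> \<le> w j * (C / ((E j)\<^sup>2 + 1))"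
      by (intro mult_left_mono) auto
    then show ?thesis using False by (simp add: regular_term_def abs_mult mult_ac)
  qed
  then show ?thesis by (rule that)
qed

lemma summable_regular_term:
  assumes "E b \<le> l" "l \<le> E (Suc b)"
  shows "summable (\<lambda>j. \<bar>regular_term b l j\<bar>)"
proof -
  obtain C where C: "\<And>j l. \<lbrakk>E b \<le> l; l \<le> E (Suc b)\<rbrakk> \<Longrightarrow>
      norm (regular_term b l j) \<le> C * (w j / ((E j)\<^sup>2 + 1))"
    using regular_term_majorant by blast
  show ?thesis
    by (rule summable_comparison_test'[OF summable_mult[OF summable_inverse_square, of C]])
      (use C[OF assms] in simp)
qed

lemma continuous_on_regular_part: "continuous_on {E b..E (Suc b)} (regular_part b)"
proof -
  obtain C where C: "\<And>j l. \<lbrakk>E b \<le> l; l \<le> E (Suc b)\<rbrakk> \<Longrightarrow>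
      norm (regular_term b l j) \<le> C * (w j / ((E j)\<^sup>2 + 1))"
    using regular_term_majorant by blast
  have "uniform_limit {E b..E (Suc b)} (\<lambda>n l. \<Sum>j<n. regular_term b l j)
      (\<lambda>l. \<Sum>j. regular_term b l j) sequentially"
    by (rule Weierstrass_m_test[OF _ summable_mult[OF summable_inverse_square]]) (use C in auto)
  moreover have "continuous_on {E b..E (Suc b)} (\<lambda>l. regular_term b l j)" for j
  proof (cases "j = b \<or> j = Suc b")
    case True
    then show ?thesis by (simp add: regular_term_def)
  next
    case False
    then have "\<forall>l\<in>{E b..E (Suc b)}. E j - l \<noteq> 0" using outside_gap[of j b] by auto
    then show ?thesis using False unfolding regular_term_def spectral_term_def
      by (auto intro!: continuous_intros)
  qed
  ultimately have "continuous_on {E b..E (Suc b)} (\<lambda>l. \<Sum>j. regular_term b l j)"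
    by (intro uniform_limit_theorem[of _ "\<lambda>n l. \<Sum>j<n. regular_term b l j" sequentially])
      (auto intro!: always_eventually continuous_on_sum)
  then show ?thesis unfolding regular_part_def[abs_def] by (intro continuous_on_diff continuous_on_const)
qed

lemma spectral_sums:
  assumes l: "E b < l" "l < E (Suc b)"
  shows "(\<lambda>j. w j * spectral_term l j) sums
    (w b / (E b - l) + w (Suc b) / (E (Suc b) - l) + regular_part b l)"
proof -
  have "(\<lambda>j. if j \<in> {b, Suc b} then w j * spectral_term l j else 0) sums
      (\<Sum>j\<in>{b, Suc b}. w j * spectral_term l j)"
    by (rule sums_If_finite_set) simp
  moreover have "summable (regular_term b l)"
    using summable_regular_term[of b l] l by (auto intro: summable_rabs_cancel)
  then have "regular_term b l sums (\<Sum>j. regular_term b l j)" by (rule summable_sums)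
  ultimately have "(\<lambda>j. (if j \<in> {b, Suc b} then w j * spectral_term l j else 0) + regular_term b l j) sums
      ((\<Sum>j\<in>{b, Suc b}. w j * spectral_term l j) + (\<Sum>j. regular_term b l j))"
    by (rule sums_add)
  moreover have "(if j \<in> {b, Suc b} then w j * spectral_term l j else 0) + regular_term b l j
      = w j * spectral_term l j" for j
    by (simp add: regular_term_def)
  moreover have "(\<Sum>j\<in>{b, Suc b}. w j * spectral_term l j) + (\<Sum>j. regular_term b l j)
      = w b / (E b - l) + w (Suc b) / (E (Suc b) - l) + regular_part b l"
    by (simp add: regular_part_def spectral_term_def right_diff_distrib)
  ultimately show ?thesis by simp
qed

text \<open>Multiplying the spectral function by \<open>(l - E b) * (E (Suc b) - l)\<close> clears
  both poles. The product \<open>P\<close> is continuous on the closed interval, negative at the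
  left end because of \<open>w b\<close> and positive at the right end because of
  \<open>w (Suc b)\<close>.\<close>

lemma spectral_zero_exists:
  obtains l where "E b < l" "l < E (Suc b)"
    "w (Suc b) * (l - E b) - w b * (E (Suc b) - l) + regular_part b l * ((l - E b) * (E (Suc b) - l)) = 0"
proof -
  define P where "P l = w (Suc b) * (l - E b) - w b * (E (Suc b) - l)
    + regular_part b l * ((l - E b) * (E (Suc b) - l))" for l
  have lt: "E b < E (Suc b)" using E_mono by (simp add: strict_mono_Suc_iff)
  have "continuous_on {E b..E (Suc b)} P"
    unfolding P_def by (intro continuous_intros continuous_on_regular_part)
  moreover have Pb: "P (E b) < 0" using lt w_positive[of b] Phi_in(2)[of b] by (simp add: P_def)
  moreover have Pc: "0 < P (E (Suc b))" using lt w_positive[of "Suc b"] Phi_in(2)[of "Suc b"] by (simp add: P_def)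
  ultimately obtain l where l: "E b \<le> l" "l \<le> E (Suc b)" "P l = 0"
    using IVT'[of P "E b" 0 "E (Suc b)"] lt by auto
  moreover have "l \<noteq> E b" "l \<noteq> E (Suc b)" using l Pb Pc by auto
  ultimately show ?thesis using that[of l] by (auto simp: P_def)
qed

lemma spectral_zero:
  assumes l: "E b < l" "l < E (Suc b)"
    and P: "w (Suc b) * (l - E b) - w b * (E (Suc b) - l) + regular_part b l * ((l - E b) * (E (Suc b) - l)) = 0"
  shows "(\<lambda>j. w j * spectral_term l j) sums 0"
proof -
  have "w b / (E b - l) + w (Suc b) / (E (Suc b) - l) + regular_part b l
      = (w (Suc b) * (l - E b) - w b * (E (Suc b) - l) + regular_part b l * ((l - E b) * (E (Suc b) - l)))
        / ((l - E b) * (E (Suc b) - l))"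
  proof -
    have "wb / (- x) + wc / y + R = (wc * x - wb * y + R * (x * y)) / (x * y)"
      if "0 < x" "0 < y" for x y wb wc R :: real
      using that by (simp add: field_simps)
    from this[of "l - E b" "E (Suc b) - l"] show ?thesis using l by simp
  qed
  then show ?thesis using spectral_sums[OF l] P by simp
qed

section \<open>Approximation by quasimodes\<close>

lemma cmod_green_coeff: "(cmod (green_coeff (of_real l) j))\<^sup>2 = w j / (E j - l)\<^sup>2"
proof -
  have "cmod (green_coeff (of_real l) j) = cmod (\<Phi> j p) / \<bar>E j - l\<bar>"
    unfolding green_coeff_def norm_divide complex_mod_cnj by (metis norm_of_real of_real_diff)
  then show ?thesis by (simp add: power_divide)
qed

lemma cmod_green_coeff_diff:
  "(cmod (green_coeff (of_real l) j - green_coeff (of_real m) j))\<^sup>2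
    = w j * \<bar>1 / (E j - l) - 1 / (E j - m)\<bar>\<^sup>2"
proof -
  have "green_coeff (of_real l) j - green_coeff (of_real m) j
      = cnj (\<Phi> j p) * of_real (1 / (E j - l) - 1 / (E j - m))"
    by (simp add: green_coeff_def right_diff_distrib)
  then have "cmod (green_coeff (of_real l) j - green_coeff (of_real m) j)
      = cmod (\<Phi> j p) * \<bar>1 / (E j - l) - 1 / (E j - m)\<bar>"
    by (simp only: norm_mult complex_mod_cnj norm_of_real)
  then show ?thesis by (simp add: power_mult_distrib)
qed

text \<open>Parseval splits the squared distance. At \<open>b\<close> and \<open>Suc b\<close> the
  coefficients have relative error \<open>\<eta>\<close>; at all other indices the quasimode has
  none, and the remainder is at most \<open>C * sqrt l / g\<^sup>2\<close>, to be compared with the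
  large norm of the quasimode. \<open>Q\<close> and \<open>K\<close> are fixed first, so the
  estimate is uniform along a sequence.\<close>

lemma eigenfunction_near_quasimode:
  assumes c0: "0 < c0" "\<And>j. c0 \<le> cmod (\<Phi> j p)"
  obtains Q K where "0 < Q" "1 \<le> K"
    "\<And>b g l m \<gamma>. \<lbrakk>K \<le> E b; 0 < g; g \<le> 1; \<And>j. \<lbrakk>j \<noteq> b; j \<noteq> Suc b\<rbrakk> \<Longrightarrow> g \<le> \<bar>E j - l\<bar>;
      E b < l; l < E (Suc b);
      w (Suc b) * (l - E b) - w b * (E (Suc b) - l) + regular_part b l * ((l - E b) * (E (Suc b) - l)) = 0;
      E b < m; m < E (Suc b); w (Suc b) * (m - E b) = w b * (E (Suc b) - m);
      expands (green_coeff (of_real l)) \<gamma>\<rbrakk> \<Longrightarrow>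
      l2norm \<mu> (\<lambda>x. \<gamma> x - (\<Sum>j\<in>{b, Suc b}. green_coeff (of_real m) j * \<Phi> j x))
        \<le> Q * (sqrt l * (E (Suc b) - E b) / g)
          * l2norm \<mu> (\<lambda>x. \<Sum>j\<in>{b, Suc b}. green_coeff (of_real m) j * \<Phi> j x)"
proof -
  obtain C K where C: "0 < C" "1 \<le> K" and bounds:
    "\<And>l g J. \<lbrakk>K \<le> l; 0 < g; g \<le> 1; finite J; \<And>j. j \<in> J \<Longrightarrow> g \<le> \<bar>E j - l\<bar>\<rbrakk> \<Longrightarrow>
      (\<Sum>j\<in>J. w j * \<bar>1 / (E j - l) - E j / ((E j)\<^sup>2 + 1)\<bar>) \<le> C * sqrt l / g \<and>
      (\<Sum>j\<in>J. w j / (E j - l)\<^sup>2) \<le> C * sqrt l / g\<^sup>2"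
    using remainder_bounds by blast
  \<comment> \<open>The quotient is the remainder bound divided by
    \<open>s \<ge> 2 * c0\<^sup>2\<close>. The 1 is due to the two regularising terms, whose joint
    bound \<open>s\<close> cancels against the denominator.\<close>
  define q where "q = C / (2 * c0\<^sup>2) + 1"
  define Q where "Q = sqrt (q\<^sup>2 + C / c0\<^sup>2)"
  have q: "0 < q" using C c0 by (simp add: q_def add_pos_pos)
  have Q2: "Q\<^sup>2 = q\<^sup>2 + C / c0\<^sup>2" and Q: "0 < Q"
    using q C c0 by (auto simp: Q_def add_pos_pos add_nonneg_pos)
  have cw: "c0\<^sup>2 \<le> w j" for j using c0 by (intro power_mono) auto
  show ?thesis
  proof (rule that[OF Q C(2)])
    fix b :: nat and g l m :: real and \<gamma>
    assume Kb: "K \<le> E b" and g: "0 < g" "g \<le> 1"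
      and gap: "\<And>j. \<lbrakk>j \<noteq> b; j \<noteq> Suc b\<rbrakk> \<Longrightarrow> g \<le> \<bar>E j - l\<bar>"
      and l: "E b < l" "l < E (Suc b)"
      and zero_l: "w (Suc b) * (l - E b) - w b * (E (Suc b) - l)
        + regular_part b l * ((l - E b) * (E (Suc b) - l)) = 0"
      and m: "E b < m" "m < E (Suc b)" "w (Suc b) * (m - E b) = w b * (E (Suc b) - m)"
      and \<gamma>: "expands (green_coeff (of_real l)) \<gamma>"
    let ?J = "{b, Suc b}"
    let ?\<psi> = "\<lambda>x. \<Sum>j\<in>?J. green_coeff (of_real m) j * \<Phi> j x"
    define s \<delta> X P where "s = w b + w (Suc b)" and "\<delta> = E (Suc b) - E b"
      and "X = sqrt l * \<delta> / g" and "P = (l2norm \<mu> ?\<psi>)\<^sup>2"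
    have s: "2 * c0\<^sup>2 \<le> s" using cw[of b] cw[of "Suc b"] by (simp add: s_def)
    have spos: "0 < s" using s c0 zero_less_power[OF c0(1), of 2] by linarith
    have \<delta>: "0 < \<delta>" using l by (simp add: \<delta>_def)
    have Kl: "K \<le> l" and l1: "1 \<le> l" using Kb l C by auto
    have sl: "1 \<le> sqrt l" "sqrt l \<le> l"
      using l1 by (auto intro!: real_le_lsqrt simp: power2_eq_square)
    have tail: "(\<Sum>j\<in>{..<n} - ?J. w j * \<bar>1 / (E j - l) - E j / ((E j)\<^sup>2 + 1)\<bar>) \<le> C * sqrt l / g"
      "(\<Sum>j\<in>{..<n} - ?J. w j / (E j - l)\<^sup>2) \<le> C * sqrt l / g\<^sup>2" for n
      using bounds[OF Kl g, of "{..<n} - ?J"] gap by auto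
    \<comment> \<open>Leads to \<open>\<delta> \<le> X\<close>, by which the error term lacking the
      factor \<open>sqrt l / g\<close> is absorbed into \<open>X\<close>.\<close>
    have "g \<le> sqrt l" using g sl by linarith
    then have "\<delta> * 1 \<le> \<delta> * (sqrt l / g)" using g \<delta> by (intro mult_left_mono) auto
    then have \<delta>X: "\<delta> \<le> X" by (simp add: X_def mult.commute)
    have X: "0 < X" using \<delta> \<delta>X by linarith

    have sm: "summable (\<lambda>j. \<bar>regular_term b l j\<bar>)" using l by (intro summable_regular_term) auto
    have "\<bar>\<Sum>j. regular_term b l j\<bar> \<le> (\<Sum>j. \<bar>regular_term b l j\<bar>)" by (rule summable_rabs[OF sm])
    also have "\<dots> \<le> C * sqrt l / g"
    proof (rule suminf_le_const[OF sm])
      fix n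
      have "(\<Sum>j<n. \<bar>regular_term b l j\<bar>) = (\<Sum>j\<in>{..<n} - ?J. w j * \<bar>1 / (E j - l) - E j / ((E j)\<^sup>2 + 1)\<bar>)"
        by (intro sum.mono_neutral_cong_right) (auto simp: regular_term_def spectral_term_def abs_mult)
      also have "\<dots> \<le> C * sqrt l / g" by (rule tail)
      finally show "(\<Sum>j<n. \<bar>regular_term b l j\<bar>) \<le> C * sqrt l / g" .
    qed
    finally have R1: "\<bar>\<Sum>j. regular_term b l j\<bar> \<le> C * sqrt l / g" .
    have e1: "\<bar>w j * (E j / ((E j)\<^sup>2 + 1))\<bar> \<le> w j" for j
    proof -
      have "\<bar>E j\<bar> \<le> (E j)\<^sup>2 + 1" using sum_squares_bound[of "\<bar>E j\<bar>" 1] by auto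
      moreover have "0 < (E j)\<^sup>2 + 1" by (simp add: add_nonneg_pos)
      ultimately have "\<bar>E j / ((E j)\<^sup>2 + 1)\<bar> \<le> 1" by (simp add: abs_divide)
      then show ?thesis
        using mult_left_mono[of "\<bar>E j / ((E j)\<^sup>2 + 1)\<bar>" 1 "w j"] by (simp only: abs_mult) simp
    qed
    have R: "\<bar>regular_part b l\<bar> \<le> C * sqrt l / g + s"
      using R1 e1[of b] e1[of "Suc b"] unfolding regular_part_def s_def by linarith
    define \<eta> where "\<eta> = \<bar>regular_part b l\<bar> * \<delta> / s"
    have \<eta>0: "0 \<le> \<eta>" using \<delta> spos by (simp add: \<eta>_def)
    have "\<eta> \<le> (C * sqrt l / g + s) * \<delta> / s"
      unfolding \<eta>_def using R \<delta> spos by (intro divide_right_mono mult_right_mono) auto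
    also have "\<dots> = C * X / s + \<delta>" using spos by (simp add: X_def field_simps)
    also have "\<dots> \<le> C * X / (2 * c0\<^sup>2) + X"
      using s spos c0 C X \<delta>X by (intro add_mono divide_left_mono) auto
    also have "\<dots> = q * X" by (simp add: q_def algebra_simps)
    finally have \<eta>: "\<eta> \<le> q * X" .
    have pert: "\<bar>1 / (E j - l) - 1 / (E j - m)\<bar> \<le> \<eta> * \<bar>1 / (E j - m)\<bar>" if "j \<in> ?J" for j
      using pole_perturbation[OF w_positive w_positive l m(1,2) zero_l m(3)] that
      by (auto simp: \<eta>_def s_def \<delta>_def)

    have P: "P = (\<Sum>j\<in>?J. w j / (E j - m)\<^sup>2)"
      unfolding P_def by (subst l2norm_sum) (simp_all add: cmod_green_coeff)
    \<comment> \<open>\<open>m\<close> is within \<open>\<delta>\<close> of \<open>E b\<close>, so a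
      single coefficient already makes the quasimode large.\<close>
    have "c0\<^sup>2 / \<delta>\<^sup>2 \<le> w b / (E b - m)\<^sup>2"
    proof (rule frac_le)
      show "(E b - m)\<^sup>2 \<le> \<delta>\<^sup>2" using m abs_le_square_iff[of "E b - m" \<delta>] by (simp add: \<delta>_def)
    qed (use cw m in auto)
    also have "\<dots> \<le> P" unfolding P using w_positive[of "Suc b"] by simp
    finally have Plow: "c0\<^sup>2 / \<delta>\<^sup>2 \<le> P" .

    have d: "expands (\<lambda>j. green_coeff (of_real l) j - (if j \<in> ?J then green_coeff (of_real m) j else 0))
        (\<lambda>x. \<gamma> x - ?\<psi> x)"
      by (intro expands_diff \<gamma> expands_finite) simp
    define t where "t j = (cmod (green_coeff (of_real l) j
      - (if j \<in> ?J then green_coeff (of_real m) j else 0)))\<^sup>2" for j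
    have tsums: "t sums (l2norm \<mu> (\<lambda>x. \<gamma> x - ?\<psi> x))\<^sup>2"
      unfolding t_def by (rule expands_l2norm[OF d])
    have tJ: "t j \<le> \<eta>\<^sup>2 * (w j / (E j - m)\<^sup>2)" if "j \<in> ?J" for j
    proof -
      have "t j = w j * \<bar>1 / (E j - l) - 1 / (E j - m)\<bar>\<^sup>2"
        unfolding t_def if_P[OF that] by (rule cmod_green_coeff_diff)
      also have "\<dots> \<le> w j * (\<eta> * \<bar>1 / (E j - m)\<bar>)\<^sup>2"
        using pert[OF that] by (intro mult_left_mono power_mono) auto
      finally show ?thesis by (simp add: power_mult_distrib power_divide mult_ac)
    qed
    have "(\<Sum>j. t j) \<le> \<eta>\<^sup>2 * P + C * sqrt l / g\<^sup>2"
    proof (rule suminf_le_const[OF sums_summable[OF tsums]])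
      fix n
      have "(\<Sum>j<n. t j) \<le> sum t (?J \<union> ({..<n} - ?J))"
        by (intro sum_mono2) (auto simp: t_def)
      also have "\<dots> = sum t ?J + sum t ({..<n} - ?J)"
        by (intro sum.union_disjoint) auto
      also have "sum t ?J \<le> (\<Sum>j\<in>?J. \<eta>\<^sup>2 * (w j / (E j - m)\<^sup>2))" by (intro sum_mono tJ)
      also have "\<dots> = \<eta>\<^sup>2 * P" unfolding P by (simp only: sum_distrib_left)
      also have "sum t ({..<n} - ?J) = (\<Sum>j\<in>{..<n} - ?J. w j / (E j - l)\<^sup>2)"
        by (intro sum.cong) (auto simp: t_def cmod_green_coeff)
      also have "\<dots> \<le> C * sqrt l / g\<^sup>2" by (rule tail)
      finally show "(\<Sum>j<n. t j) \<le> \<eta>\<^sup>2 * P + C * sqrt l / g\<^sup>2" by simp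
    qed
    then have "(l2norm \<mu> (\<lambda>x. \<gamma> x - ?\<psi> x))\<^sup>2 \<le> \<eta>\<^sup>2 * P + C * sqrt l / g\<^sup>2"
      using sums_unique[OF tsums] by simp
    also have "\<dots> \<le> (q * X)\<^sup>2 * P + C / c0\<^sup>2 * X\<^sup>2 * P"
    proof (rule add_mono)
      show "\<eta>\<^sup>2 * P \<le> (q * X)\<^sup>2 * P"
        using \<eta> \<eta>0 by (intro mult_right_mono power_mono) (auto simp: P_def)
      \<comment> \<open>Replacing \<open>sqrt l\<close> by \<open>l\<close> is wasteful but produces
        the square of \<open>X\<close>, so both contributions take the same form.\<close>
      have "C * sqrt l / g\<^sup>2 \<le> C * l / g\<^sup>2"
        using sl C by (intro divide_right_mono mult_left_mono) auto
      also have "\<dots> = C / c0\<^sup>2 * X\<^sup>2 * (c0\<^sup>2 / \<delta>\<^sup>2)"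
        using l1 \<delta> c0 by (simp add: X_def power_divide power_mult_distrib)
      also have "\<dots> \<le> C / c0\<^sup>2 * X\<^sup>2 * P" using Plow C by (intro mult_left_mono) auto
      finally show "C * sqrt l / g\<^sup>2 \<le> C / c0\<^sup>2 * X\<^sup>2 * P" .
    qed
    also have "\<dots> = (Q * X * l2norm \<mu> ?\<psi>)\<^sup>2"
      by (simp add: P_def power_mult_distrib Q2 algebra_simps)
    finally have "l2norm \<mu> (\<lambda>x. \<gamma> x - ?\<psi> x) \<le> Q * X * l2norm \<mu> ?\<psi>"
      by (rule power2_le_imp_le) (use Q X in simp)
    then show "l2norm \<mu> (\<lambda>x. \<gamma> x - ?\<psi> x)
        \<le> Q * (sqrt l * (E (Suc b) - E b) / g) * l2norm \<mu> ?\<psi>"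
      by (simp only: X_def \<delta>_def)
  qed
qed

section \<open>Normalised eigenfunctions along the sequence and their convergence\<close>

lemma expands_norm_pos:
  assumes "expands c f" "c j \<noteq> 0"
  shows "0 < l2norm \<mu> f"
proof -
  have "0 < (\<Sum>j. (cmod (c j))\<^sup>2)"
    using assms(2) by (intro suminf_pos2[OF sums_summable[OF expands_l2norm[OF assms(1)]], of j]) auto
  then have "0 < (l2norm \<mu> f)\<^sup>2" using sums_unique[OF expands_l2norm[OF assms(1)]] by simp
  then show ?thesis using l2norm_nonneg[of \<mu> f] by (simp add: less_le)
qed

text \<open>Finitely many gaps start at or below \<open>K\<close>, and all are positive, so
  sufficiently small gaps can only occur above \<open>K\<close>. This provides the energy threshold
  of \<open>eigenfunction_near_quasimode\<close>.\<close>

lemma energies_unbounded_of_small_gaps: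
  assumes "(\<lambda>n. E (Suc (b n)) - E (b n)) \<longlonglongrightarrow> 0"
  shows "\<forall>\<^sub>F n in sequentially. K \<le> E (b n)"
proof -
  \<comment> \<open>The inserted 1 keeps \<open>Min\<close> meaningful when no energy is at most
    \<open>K\<close>.\<close>
  define d where "d = Min (insert 1 ((\<lambda>j. E (Suc j) - E j) ` {j. E j \<le> K}))"
  have "0 < d" unfolding d_def using finite_below[of K] E_mono by (auto simp: strict_mono_Suc_iff)
  with assms have "\<forall>\<^sub>F n in sequentially. E (Suc (b n)) - E (b n) < d"
    by (rule order_tendstoD(2))
  then show ?thesis
  proof eventually_elim
    case (elim n)
    show ?case
    proof (rule ccontr)
      assume "\<not> K \<le> E (b n)"
      then have "d \<le> E (Suc (b n)) - E (b n)"
        unfolding d_def using finite_below[of K] by (intro Min_le) auto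
      with elim show False by simp
    qed
  qed
qed

lemma normalised_eigenfunction_exists:
  assumes l: "E b < l" "l < E (Suc b)"
    and zero: "w (Suc b) * (l - E b) - w b * (E (Suc b) - l)
      + regular_part b l * ((l - E b) * (E (Suc b) - l)) = 0"
  obtains \<gamma> where "expands (green_coeff (of_real l)) \<gamma>" "0 < l2norm \<mu> \<gamma>"
    "normalised_eigenfunction \<mu> (H_op \<mu> M \<Delta> p \<Phi> E pi) (\<lambda>x. of_real (1 / l2norm \<mu> \<gamma>) * \<gamma> x)"
proof -
  have "E j < l \<or> l < E j" for j
    using l E_mono strict_mono_less_eq[of E j b] strict_mono_less_eq[of E "Suc b" j]
    by (cases "j \<le> b") (auto simp: not_le Suc_le_eq)
  \<comment> \<open>The interval is degenerate here: the gap is wanted at the single point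
    \<open>l\<close>, but relative to all energies at once.\<close>
  then obtain \<kappa> where \<kappa>: "0 < \<kappa>" "\<And>j. \<kappa> * (1 + \<bar>E j\<bar>) \<le> \<bar>E j - l\<bar>"
    using uniform_gap[of UNIV l l] by auto
  then obtain \<gamma> where \<gamma>: "expands (green_coeff (of_real l)) \<gamma>"
    by (rule green_coeff_expands)
  have "green_coeff (of_real l) b \<noteq> 0"
    using l(1) Phi_in(2)[of b] by (simp add: green_coeff_def)
  then have pos: "0 < l2norm \<mu> \<gamma>" by (rule expands_norm_pos[OF \<gamma>])
  have "l2norm \<mu> (\<lambda>x. of_real (1 / l2norm \<mu> \<gamma>) * \<gamma> x) = 1"
    using pos unfolding l2norm_scale norm_of_real by simp
  then have "normalised_eigenfunction \<mu> (H_op \<mu> M \<Delta> p \<Phi> E pi) (\<lambda>x. of_real (1 / l2norm \<mu> \<gamma>) * \<gamma> x)"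
    unfolding normalised_eigenfunction_def
    using eigenfunction[OF \<kappa> spectral_zero[OF l zero] \<gamma>] by blast
  with \<gamma> pos show ?thesis by (rule that)
qed

text \<open>Works with an abstract gap \<open>g n\<close> in place of powers of
  \<open>\<epsilon> n\<close>. The sequence in \<open>lim\<close> is the relative error of
  \<open>eigenfunction_near_quasimode\<close>, with \<open>E (Suc (b n))\<close> in place of the
  zero \<open>l n\<close> below it.\<close>

lemma quasimodes_converge:
  fixes b :: "nat \<Rightarrow> nat" and m g :: "nat \<Rightarrow> real" and \<psi> :: "nat \<Rightarrow> 'a \<Rightarrow> complex"
  assumes c0: "0 < c0" "\<And>j. c0 \<le> cmod (\<Phi> j p)"
    and m: "\<And>n. E (b n) < m n" "\<And>n. m n < E (Suc (b n))"
      "\<And>n. w (Suc (b n)) * (m n - E (b n)) = w (b n) * (E (Suc (b n)) - m n)"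
    and \<psi>: "\<And>n. \<psi> n = (\<lambda>x. \<Sum>j\<in>{b n, Suc (b n)}. green_coeff (of_real (m n)) j * \<Phi> j x)"
    and g: "\<And>n. 0 < g n" "\<forall>\<^sub>F n in sequentially. g n \<le> 1"
    and gap: "\<And>n j. j < b n \<Longrightarrow> g n \<le> E (b n) - E j"
      "\<And>n j. Suc (b n) < j \<Longrightarrow> g n \<le> E j - E (Suc (b n))"
    and small: "(\<lambda>n. E (Suc (b n)) - E (b n)) \<longlonglongrightarrow> 0"
    and lim: "(\<lambda>n. sqrt (E (Suc (b n))) * (E (Suc (b n)) - E (b n)) / g n) \<longlonglongrightarrow> 0"
  shows "\<exists>\<phi>. (\<forall>n. normalised_eigenfunction \<mu> (H_op \<mu> M \<Delta> p \<Phi> E pi) (\<phi> n)) \<and>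
    (\<lambda>n. l2norm \<mu> (\<lambda>x. \<phi> n x - \<psi> n x / of_real (l2norm \<mu> (\<psi> n)))) \<longlonglongrightarrow> 0"
proof -
  have "\<exists>l. E (b n) < l \<and> l < E (Suc (b n)) \<and> w (Suc (b n)) * (l - E (b n)) - w (b n) * (E (Suc (b n)) - l)
      + regular_part (b n) l * ((l - E (b n)) * (E (Suc (b n)) - l)) = 0" for n
    using spectral_zero_exists[of "b n"] by blast
  then obtain l where l: "\<And>n. E (b n) < l n" "\<And>n. l n < E (Suc (b n))"
    "\<And>n. w (Suc (b n)) * (l n - E (b n)) - w (b n) * (E (Suc (b n)) - l n)
      + regular_part (b n) (l n) * ((l n - E (b n)) * (E (Suc (b n)) - l n)) = 0"
    by metis
  have "\<forall>n. \<exists>\<gamma>. expands (green_coeff (of_real (l n))) \<gamma> \<and> 0 < l2norm \<mu> \<gamma> \<and>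
      normalised_eigenfunction \<mu> (H_op \<mu> M \<Delta> p \<Phi> E pi) (\<lambda>x. of_real (1 / l2norm \<mu> \<gamma>) * \<gamma> x)"
    by (rule allI, rule normalised_eigenfunction_exists[OF l]) blast
  from choice[OF this] obtain \<gamma> where \<gamma>: "\<And>n. expands (green_coeff (of_real (l n))) (\<gamma> n)" "\<And>n. 0 < l2norm \<mu> (\<gamma> n)"
    and eigen: "\<And>n. normalised_eigenfunction \<mu> (H_op \<mu> M \<Delta> p \<Phi> E pi)
      (\<lambda>x. of_real (1 / l2norm \<mu> (\<gamma> n)) * \<gamma> n x)"
    by blast
  have \<psi>_expands: "expands (\<lambda>j. if j \<in> {b n, Suc (b n)} then green_coeff (of_real (m n)) j else 0) (\<psi> n)" for n
    unfolding \<psi> by (rule expands_finite) simp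
  have \<psi>_pos: "0 < l2norm \<mu> (\<psi> n)" for n
    by (rule expands_norm_pos[OF \<psi>_expands, of "b n"])
      (use m(1)[of n] Phi_in(2)[of "b n"] in \<open>simp add: green_coeff_def\<close>)
  obtain Q K where QK: "0 < Q" "1 \<le> K"
    and near: "\<And>b g l m \<gamma>. \<lbrakk>K \<le> E b; 0 < g; g \<le> 1; \<And>j. \<lbrakk>j \<noteq> b; j \<noteq> Suc b\<rbrakk> \<Longrightarrow> g \<le> \<bar>E j - l\<bar>;
      E b < l; l < E (Suc b);
      w (Suc b) * (l - E b) - w b * (E (Suc b) - l) + regular_part b l * ((l - E b) * (E (Suc b) - l)) = 0;
      E b < m; m < E (Suc b); w (Suc b) * (m - E b) = w b * (E (Suc b) - m);
      expands (green_coeff (of_real l)) \<gamma>\<rbrakk> \<Longrightarrow>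
      l2norm \<mu> (\<lambda>x. \<gamma> x - (\<Sum>j\<in>{b, Suc b}. green_coeff (of_real m) j * \<Phi> j x))
        \<le> Q * (sqrt l * (E (Suc b) - E b) / g)
          * l2norm \<mu> (\<lambda>x. \<Sum>j\<in>{b, Suc b}. green_coeff (of_real m) j * \<Phi> j x)"
    using eigenfunction_near_quasimode[OF c0] by blast
  \<comment> \<open>Eigenfunctions are chosen for every \<open>n\<close>, but the estimate applies
    only once the energy has passed \<open>K\<close> and \<open>g n\<close> is at most 1.\<close>
  have "\<forall>\<^sub>F n in sequentially.
      norm (l2norm \<mu> (\<lambda>x. of_real (1 / l2norm \<mu> (\<gamma> n)) * \<gamma> n x - \<psi> n x / of_real (l2norm \<mu> (\<psi> n))))
        \<le> 2 * Q * (sqrt (E (Suc (b n))) * (E (Suc (b n)) - E (b n)) / g n)"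
    using energies_unbounded_of_small_gaps[OF small, of K] g(2)
  proof eventually_elim
    case (elim n)
    have gl: "g n \<le> \<bar>E j - l n\<bar>" if "j \<noteq> b n" "j \<noteq> Suc (b n)" for j
      using that gap(1)[of j n] gap(2)[of n j] l(1,2)[of n] by (cases "j < b n") force+
    let ?D = "l2norm \<mu> (\<lambda>x. \<gamma> n x - \<psi> n x)"
    have D: "?D \<le> Q * (sqrt (l n) * (E (Suc (b n)) - E (b n)) / g n) * l2norm \<mu> (\<psi> n)"
      using near[OF elim(1) g(1) elim(2) gl l[of n] m[of n] \<gamma>(1)] unfolding \<psi> by blast
    have "l2norm \<mu> (\<lambda>x. of_real (1 / l2norm \<mu> (\<gamma> n)) * \<gamma> n x - \<psi> n x / of_real (l2norm \<mu> (\<psi> n)))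
        \<le> 2 * ?D / l2norm \<mu> (\<psi> n)"
      by (rule l2norm_normalise_diff[OF l2_sums_L2[OF \<gamma>(1)] \<gamma>(2) l2_sums_L2[OF \<psi>_expands] \<psi>_pos])
    also have "\<dots> = 2 * (?D / l2norm \<mu> (\<psi> n))" by simp
    also have "\<dots> \<le> 2 * (Q * (sqrt (l n) * (E (Suc (b n)) - E (b n)) / g n))"
      by (intro mult_left_mono iffD2[OF pos_divide_le_eq[OF \<psi>_pos]] D) simp
    also have "\<dots> \<le> 2 * (Q * (sqrt (E (Suc (b n))) * (E (Suc (b n)) - E (b n)) / g n))"
      using l(1,2)[of n] g(1)[of n] QK
      by (intro mult_left_mono divide_right_mono mult_right_mono) auto
    finally show ?case by simp
  qed
  moreover have "(\<lambda>n. 2 * Q * (sqrt (E (Suc (b n))) * (E (Suc (b n)) - E (b n)) / g n)) \<longlonglongrightarrow> 2 * Q * 0"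
    by (intro tendsto_mult_left lim)
  ultimately have "(\<lambda>n. l2norm \<mu> (\<lambda>x. of_real (1 / l2norm \<mu> (\<gamma> n)) * \<gamma> n x
      - \<psi> n x / of_real (l2norm \<mu> (\<psi> n)))) \<longlonglongrightarrow> 0"
    by - (rule Lim_null_comparison, simp_all)
  with eigen show ?thesis
    by (intro exI[of _ "\<lambda>n x. of_real (1 / l2norm \<mu> (\<gamma> n)) * \<gamma> n x"] conjI allI)
qed

end

section \<open>Translation of the conditions on \<open>\<epsilon>\<close> into gaps and error
  exponents\<close>

theorem theorem4p4:
  fixes A :: "'a::{t2_space,second_countable_topology} chart set"
    and G :: "'a chart \<Rightarrow> real^2 \<Rightarrow> real^2^2"
    and vol \<mu> :: "'a measure"
    and M :: "'a set"
    and \<Delta> :: "'a operator"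
    and p :: 'a
    and B :: "('a \<Rightarrow> complex) set"
    and \<Phi> :: "nat \<Rightarrow> 'a \<Rightarrow> complex"
    and E :: "nat \<Rightarrow> real"
    and q \<rho> c0 :: real
    and \<epsilon> E_a E_b E_c E_d m :: "nat \<Rightarrow> real"
    and I :: "nat \<Rightarrow> real set"
    and \<psi> :: "nat \<Rightarrow> 'a \<Rightarrow> complex"
  assumes setting: "point_scatterer A G vol M \<mu> \<Delta> p B \<Phi> E"
    and q: "0 < q" "q < 1/2"
    and rho: "1 < \<rho>" "\<rho> < 2 * (1 - q)"
    and eps: "\<And>n. 0 < \<epsilon> n" "decseq \<epsilon>" "\<epsilon> \<longlonglongrightarrow> 0"
    and consecutive: "\<And>n. \<exists>j. E_a n = E j \<and> E_b n = E (j + 1) \<and> E_c n = E (j + 2) \<and> E_d n = E (j + 3)"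
    and A1: "E_d \<lless> (\<lambda>n. \<epsilon> n powr (- \<rho>))"
    and A2: "(\<lambda>n. E_c n - E_b n) \<lless> \<epsilon>"
    and A3: "(\<lambda>n. \<epsilon> n powr q) \<lless> (\<lambda>n. E_d n - E_c n)"
    and A4: "(\<lambda>n. \<epsilon> n powr q) \<lless> (\<lambda>n. E_b n - E_a n)"
    and B: "0 < c0" "\<And>j. c0 \<le> cmod (\<Phi> j p)"
    and I: "\<And>n. I n = {E_b n..E_c n}"
    and m: "\<And>n. m n \<in> I n" "\<And>n. m n \<notin> range E"
           "\<And>n. (\<Sum>j\<in>{j. E j \<in> I n}. (cmod (\<Phi> j p))\<^sup>2 / (E j - m n)) = 0"
    and psi: "\<And>n. \<psi> n = quasimode \<Phi> E p (I n) (m n)"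
  shows "\<exists>\<phi>. (\<forall>n. normalised_eigenfunction \<mu> (H_op \<mu> M \<Delta> p \<Phi> E pi) (\<phi> n)) \<and>
    (\<lambda>n. l2norm \<mu> (\<lambda>x. \<phi> n x - \<psi> n x / of_real (l2norm \<mu> (\<psi> n)))) \<longlonglongrightarrow> 0"
proof -
  interpret point_scatterer A G vol M \<mu> \<Delta> p B \<Phi> E by (rule setting)
  obtain a where a: "\<And>n. E_a n = E (a n)" "\<And>n. E_b n = E (Suc (a n))"
    "\<And>n. E_c n = E (Suc (Suc (a n)))" "\<And>n. E_d n = E (Suc (Suc (Suc (a n))))"
    using consecutive by (simp add: eval_nat_numeral) metis
  define b where "b n = Suc (a n)" for n
  have Eb: "E_b n = E (b n)" "E_c n = E (Suc (b n))" for n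
    using a by (auto simp: b_def)
  have In: "{j. E j \<in> I n} = {b n, Suc (b n)}" for n
    using E_mono by (auto simp: I Eb strict_mono_less_eq)
  have lt: "E_b n < m n" "m n < E_c n" for n
  proof -
    \<comment> \<open>Avoiding the energies turns membership in the closed interval into strict
      inequalities.\<close>
    have ne: "m n \<noteq> E j" for j using m(2)[of n] by auto
    show "E_b n < m n" "m n < E_c n"
      using m(1)[of n] unfolding I Eb by (simp_all add: less_le ne ne[symmetric])
  qed
  have mw: "w (Suc (b n)) * (m n - E (b n)) = w (b n) * (E (Suc (b n)) - m n)" for n
  proof -
    have balance: "wc * x = wb * y" if "wb / (- x) + wc / y = 0" "0 < x" "0 < y" for x y wb wc :: real
      using that by (simp add: field_simps)
    have "w (b n) / (E (b n) - m n) + w (Suc (b n)) / (E (Suc (b n)) - m n) = 0"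
      using m(3)[of n] unfolding In by simp
    then show ?thesis using lt[of n] unfolding Eb by (intro balance) simp_all
  qed
  have psi_green: "\<psi> n = (\<lambda>x. \<Sum>j\<in>{b n, Suc (b n)}. green_coeff (of_real (m n)) j * \<Phi> j x)" for n
    unfolding psi quasimode_def In green_coeff_def by simp
  obtain C1 C2 C3 C4 where C: "0 < C1" "0 < C2" "0 < C3" "0 < C4"
    and A1': "\<And>n. E_d n \<le> C1 * \<epsilon> n powr (- \<rho>)"
    and A2': "\<And>n. E_c n - E_b n \<le> C2 * \<epsilon> n"
    and A3': "\<And>n. \<epsilon> n powr q \<le> C3 * (E_d n - E_c n)"
    and A4': "\<And>n. \<epsilon> n powr q \<le> C4 * (E_b n - E_a n)"
    using A1 A2 A3 A4 unfolding vless_def by metis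
  \<comment> \<open>A common constant for the gaps on both sides; the 1 ensures that
    \<open>g n\<close> is at most \<open>\<epsilon> n powr q\<close>.\<close>
  define D where "D = max 1 (max C3 C4)"
  have D: "1 \<le> D" "C3 \<le> D" "C4 \<le> D" by (auto simp: D_def)
  define g where "g n = \<epsilon> n powr q / D" for n
  have g_le: "g n \<le> y" if "\<epsilon> n powr q \<le> c * y" "0 < c" "c \<le> D" for n c y
  proof -
    have "0 \<le> c * y" using that(1) powr_ge_zero[of "\<epsilon> n" q] by linarith
    then have "0 \<le> y" using that(2) by (simp add: zero_le_mult_iff)
    then have "c * y \<le> D * y" using that(3) by (intro mult_right_mono)
    then show ?thesis using that(1) D by (simp add: g_def pos_divide_le_eq mult.commute)
  qed
  have small: "(\<lambda>n. E (Suc (b n)) - E (b n)) \<longlonglongrightarrow> 0"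
  proof (rule Lim_null_comparison[OF always_eventually])
    show "(\<lambda>n. C2 * \<epsilon> n) \<longlonglongrightarrow> 0" using tendsto_mult_left[OF eps(3), of C2] by simp
    show "\<forall>n. norm (E (Suc (b n)) - E (b n)) \<le> C2 * \<epsilon> n"
      using A2' less_trans[OF lt] unfolding Eb by (simp add: abs_of_pos)
  qed
  have "(\<lambda>n. sqrt (E (Suc (b n))) * (E (Suc (b n)) - E (b n)) / g n) \<longlonglongrightarrow> 0"
  proof (rule Lim_null_comparison)
    \<comment> \<open>The exponent collects 1 from the gap \<open>E_c n - E_b n\<close>,
      \<open>- q\<close> from \<open>1 / g n\<close> and \<open>- \<rho> / 2\<close> from the square
      root of the energy; it is positive because \<open>\<rho> < 2 * (1 - q)\<close>.\<close>
    have "(\<lambda>n. \<epsilon> n powr (1 - q - \<rho> / 2)) \<longlonglongrightarrow> 0"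
      using rho(2) eps(1) by (intro tendsto_zero_powrI[OF eps(3) tendsto_const]) (auto simp: less_imp_le)
    from tendsto_mult_left[OF this, of "sqrt C1 * C2 * D"]
    show "(\<lambda>n. sqrt C1 * C2 * D * \<epsilon> n powr (1 - q - \<rho> / 2)) \<longlonglongrightarrow> 0" by simp
    \<comment> \<open>Excludes negative energies, so that the square root is nonnegative and the
      bounds may be multiplied.\<close>
    have "\<forall>\<^sub>F n in sequentially. 1 \<le> E (b n)" by (rule energies_unbounded_of_small_gaps[OF small])
    then show "\<forall>\<^sub>F n in sequentially. norm (sqrt (E (Suc (b n))) * (E (Suc (b n)) - E (b n)) / g n)
        \<le> sqrt C1 * C2 * D * \<epsilon> n powr (1 - q - \<rho> / 2)"
    proof eventually_elim
      case (elim n)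
      have d: "0 \<le> E (Suc (b n)) - E (b n)" "E (Suc (b n)) - E (b n) \<le> C2 * \<epsilon> n"
        using A2'[of n] lt[of n] unfolding Eb by auto
      have pos: "0 \<le> E (Suc (b n))" using elim d by linarith
      have g: "0 < g n" using eps(1)[of n] D by (simp add: g_def)
      have "E (Suc (b n)) \<le> E_d n" unfolding a(4) b_def using E_mono by (simp add: strict_mono_less_eq)
      also have "\<dots> \<le> C1 * \<epsilon> n powr (- \<rho>)" by (rule A1')
      finally have "sqrt (E (Suc (b n))) \<le> sqrt (C1 * \<epsilon> n powr (- \<rho>))"
        by (rule real_sqrt_le_mono)
      also have "\<dots> = sqrt C1 * \<epsilon> n powr (- \<rho> / 2)"
        by (simp add: real_sqrt_mult powr_powr flip: powr_half_sqrt)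
      finally have sqrt_bound: "sqrt (E (Suc (b n))) \<le> sqrt C1 * \<epsilon> n powr (- \<rho> / 2)" .
      have "sqrt (E (Suc (b n))) * (E (Suc (b n)) - E (b n)) / g n
          \<le> (sqrt C1 * \<epsilon> n powr (- \<rho> / 2)) * (C2 * \<epsilon> n) / g n"
        using sqrt_bound d g C pos eps(1)[of n] by (intro divide_right_mono mult_mono) (auto intro: less_imp_le)
      also have "\<dots> = sqrt C1 * C2 * D * (\<epsilon> n powr (- \<rho> / 2) * \<epsilon> n powr 1 / \<epsilon> n powr q)"
        using eps(1)[of n] by (simp add: g_def)
      also have "\<epsilon> n powr (- \<rho> / 2) * \<epsilon> n powr 1 / \<epsilon> n powr q = \<epsilon> n powr (1 - q - \<rho> / 2)"
        by (simp only: powr_add[symmetric] powr_diff[symmetric]) (simp add: algebra_simps)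
      finally show ?case using d g pos by simp
    qed
  qed
  then show ?thesis
  proof (rule quasimodes_converge[OF B(1) B(2) lt[unfolded Eb] mw psi_green, rotated -1])
    show "0 < g n" for n using eps(1)[of n] D by (simp add: g_def)
    have "(\<lambda>n. \<epsilon> n powr q) \<longlonglongrightarrow> 0"
      using q(1) eps(1) by (intro tendsto_zero_powrI[OF eps(3) tendsto_const]) (auto simp: less_imp_le)
    then have "\<forall>\<^sub>F n in sequentially. \<epsilon> n powr q < 1" by (rule order_tendstoD) simp
    then show "\<forall>\<^sub>F n in sequentially. g n \<le> 1"
      by eventually_elim (use D in \<open>simp add: g_def pos_divide_le_eq\<close>)
    show "g n \<le> E (b n) - E j" if "j < b n" for n j
    proof -
      have "E j \<le> E_a n" using that E_mono by (simp add: a b_def strict_mono_less_eq)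
      moreover have "g n \<le> E_b n - E_a n" by (rule g_le[OF A4' C(4) D(3)])
      ultimately show ?thesis by (simp add: Eb)
    qed
    show "g n \<le> E j - E (Suc (b n))" if "Suc (b n) < j" for n j
    proof -
      have "E_d n \<le> E j" using that E_mono by (simp add: a b_def strict_mono_less_eq)
      moreover have "g n \<le> E_d n - E_c n" by (rule g_le[OF A3' C(3) D(2)])
      ultimately show ?thesis by (simp add: Eb)
    qed
  qed (rule small)
qed

end
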